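(* Let $K$ be a field, $S=K[x_1,\dots,x_n]$, and let $I$ and $J$ be two monomial ideals of $S$ such that $I\subset J$, with radicals $\sqrt{I}$ and $\sqrt{J}$ respectively. If $\operatorname{sdepth}(J/I)=\dim(J/I)$, then $\operatorname{sdepth}(\sqrt{J}/\sqrt{I})=\dim(\sqrt{J}/\sqrt{I})$.
   Context: Let $S=K[x_1,\dots,x_n]$ be a polynomial ring over a field $K$ with its standard $\mathbb{Z}^n$-grading, and let $M$ be a finitely generated $\mathbb{Z}^n$-graded $S$-module. For a homogeneous element $w\in M$ and a subset $Z\subset\{x_1,\dots,x_n\}$, $wK[Z]$ denotes the $K$-subspace of $M$ generated by all homogeneous elements $wv$ with $v$ a monomial in $K[Z]$. It is called a Stanley space of dimension $|Z|$ if it is a free $K[Z]$-module. A Stanley decomposition of $M$ is a presentation of the $K$-vector space $M$ as a finite direct sum of Stanley spaces $\mathcal{D}: M=\bigoplus_{i=1}^s u_iK[Z_i]$, and $\operatorname{sdepth}\mathcal{D}=\min\{|Z_i| : i=1,\dots,s\}$. The Stanley depth of $M$ is $\operatorname{sdepth}(M)=\max\{\operatorname{sdepth}\mathcal{D} : \mathcal{D}\text{ is a Stanley decomposition of } M\}$. Here $\dim$ denotes the Krull dimension of a module. *)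

theory Defs
  imports
    "HOL-Algebra.Module"
    "HOL-Algebra.QuotRing"
    "HOL-Library.Poly_Mapping"
    "HOL-Library.Extended_Real"
begin

section \<open>Polynomial rings and monomial ideals\<close>

text \<open>
  The variables are indexed by natural numbers and the number of variables is a parameter:
  \<open>K[x\<^sub>1, \<dots>, x\<^sub>n]\<close> is \<open>poly_ring {..<n}\<close>, and
  for a set \<open>Z\<close> of (indices of) variables \<open>K[Z]\<close> is \<open>poly_ring Z\<close>.
  In particular \<open>poly_ring {}\<close> consists of the constant polynomials, i.e. it is \<open>K\<close> itself.
\<close>

type_synonym 'k mpoly = "(nat \<Rightarrow>\<^sub>0 nat) \<Rightarrow>\<^sub>0 'k"

definition poly_ring :: "nat set \<Rightarrow> ('k::field) mpoly ring" where
  "poly_ring Z = \<lparr>carrier = {p. \<forall>m\<in>Poly_Mapping.keys p. Poly_Mapping.keys m \<subseteq> Z},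
     mult = (*), one = 1, zero = 0, add = (+)\<rparr>"

definition monomials :: "nat set \<Rightarrow> ('k::field) mpoly set" where
  "monomials Z = {Poly_Mapping.single m 1 | m. Poly_Mapping.keys m \<subseteq> Z}"

definition monomial_ideal :: "nat \<Rightarrow> ('k::field) mpoly set \<Rightarrow> bool" where
  "monomial_ideal n I \<longleftrightarrow> (\<exists>A \<subseteq> monomials {..<n}. I = Idl\<^bsub>poly_ring {..<n}\<^esub> A)"

definition ideal_radical :: "('a, 'r) ring_scheme \<Rightarrow> 'a set \<Rightarrow> 'a set" where
  "ideal_radical R I = {x \<in> carrier R. \<exists>k::nat. k > 0 \<and> x [^]\<^bsub>R\<^esub> k \<in> I}"


section \<open>Krull dimension\<close>

text \<open>
  Dimensions and Stanley depths are extended reals, so that a supremum over the empty set is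
  \<open>-\<infinity>\<close>. The zero ring and the zero module thus have dimension \<open>-\<infinity>\<close>.
\<close>

definition krull_dim :: "('a, 'r) ring_scheme \<Rightarrow> ereal" where
  "krull_dim R = (SUP k \<in> {k. \<exists>P :: nat \<Rightarrow> 'a set.
      (\<forall>i\<le>k. primeideal (P i) R) \<and> (\<forall>i<k. P i \<subset> P (Suc i))}. ereal (real k))"

definition annihilator :: "('a, 'r) ring_scheme \<Rightarrow> ('a, 'b, 'm) module_scheme \<Rightarrow> 'a set" where
  "annihilator R M = {r \<in> carrier R. \<forall>x\<in>carrier M. r \<odot>\<^bsub>M\<^esub> x = \<zero>\<^bsub>M\<^esub>}"

definition module_dim :: "('a, 'r) ring_scheme \<Rightarrow> ('a, 'b, 'm) module_scheme \<Rightarrow> ereal" where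
  "module_dim R M = krull_dim (R Quot annihilator R M)"


section \<open>Spans and free modules\<close>

text \<open>
  The scalars \<open>R\<close> are a separate argument because an \<open>S\<close>-module \<open>M\<close>
  is also used as a module over the subrings \<open>K\<close> and \<open>K[Z]\<close> of \<open>S\<close>.
\<close>

definition lin_span ::
  "('a, 'r) ring_scheme \<Rightarrow> ('a, 'b, 'm) module_scheme \<Rightarrow> 'b set \<Rightarrow> 'b set" where
  "lin_span R M B = {(\<Oplus>\<^bsub>M\<^esub>b\<in>F. c b \<odot>\<^bsub>M\<^esub> b) | F c.
     finite F \<and> F \<subseteq> B \<and> c \<in> F \<rightarrow> carrier R}"

definition lin_indep ::
  "('a, 'r) ring_scheme \<Rightarrow> ('a, 'b, 'm) module_scheme \<Rightarrow> 'b set \<Rightarrow> bool" where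
  "lin_indep R M B \<longleftrightarrow> (\<forall>F c. finite F \<and> F \<subseteq> B \<and> c \<in> F \<rightarrow> carrier R \<and>
     (\<Oplus>\<^bsub>M\<^esub>b\<in>F. c b \<odot>\<^bsub>M\<^esub> b) = \<zero>\<^bsub>M\<^esub> \<longrightarrow> (\<forall>b\<in>F. c b = \<zero>\<^bsub>R\<^esub>))"

definition free_submodule ::
  "('a, 'r) ring_scheme \<Rightarrow> ('a, 'b, 'm) module_scheme \<Rightarrow> 'b set \<Rightarrow> bool" where
  "free_submodule R M N \<longleftrightarrow> (\<exists>B \<subseteq> N. lin_span R M B = N \<and> lin_indep R M B)"


section \<open>Stanley decompositions and Stanley depth\<close>

text \<open>
  \<open>component M a\<close> is the homogeneous component \<open>M\<^sub>a\<close>. Elements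
  of \<open>\<int>\<^sup>n\<close> are functions on \<open>nat\<close> that vanish outside \<open>{..<n}\<close>.
\<close>

record ('a, 'b) graded_module = "('a, 'b) module" +
  component :: "(nat \<Rightarrow> int) \<Rightarrow> 'b set"

definition homogeneous :: "nat \<Rightarrow> ('a, 'b, 'm) graded_module_scheme \<Rightarrow> 'b \<Rightarrow> bool" where
  "homogeneous n M w \<longleftrightarrow> (\<exists>a. (\<forall>i\<ge>n. a i = 0) \<and> w \<in> component M a)"

definition cyclic_space ::
  "(('k::field) mpoly, 'b, 'm) module_scheme \<Rightarrow> 'b \<Rightarrow> nat set \<Rightarrow> 'b set" where
  "cyclic_space M w Z = lin_span (poly_ring {}) M {v \<odot>\<^bsub>M\<^esub> w | v. v \<in> monomials Z}"

text \<open>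
  The generator is required to be nonzero: the zero space, although free (of rank 0) over every
  \<open>K[Z]\<close>, is not a Stanley space.
\<close>

definition stanley_space ::
  "nat \<Rightarrow> (('k::field) mpoly, 'b, 'm) graded_module_scheme \<Rightarrow> 'b \<Rightarrow> nat set \<Rightarrow> bool" where
  "stanley_space n M w Z \<longleftrightarrow>
     w \<in> carrier M \<and> homogeneous n M w \<and> w \<noteq> \<zero>\<^bsub>M\<^esub> \<and> Z \<subseteq> {..<n} \<and>
     free_submodule (poly_ring Z) M (cyclic_space M w Z)"

text \<open>
  A decomposition is given by its list of pairs \<open>(u\<^sub>i, Z\<^sub>i)\<close>. It is nonempty, so that
  the minimum below is defined; hence the zero module has no Stanley decomposition and
  its Stanley depth is \<open>-\<infinity>\<close>. Otherwise the supremum in \<open>sdepth\<close> ranges over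
  natural numbers \<open>\<le> n\<close>, so it is a maximum.
\<close>

definition stanley_decomposition ::
  "nat \<Rightarrow> (('k::field) mpoly, 'b, 'm) graded_module_scheme \<Rightarrow> ('b \<times> nat set) list \<Rightarrow> bool" where
  "stanley_decomposition n M D \<longleftrightarrow>
     D \<noteq> [] \<and> (\<forall>(u, Z) \<in> set D. stanley_space n M u Z) \<and>
     (\<forall>x\<in>carrier M. \<exists>!f. f \<in> (\<Pi>\<^sub>E i\<in>{..<length D}. cyclic_space M (fst (D ! i)) (snd (D ! i))) \<and>
        x = (\<Oplus>\<^bsub>M\<^esub>i\<in>{..<length D}. f i))"

definition sdepth_decomposition :: "('b \<times> nat set) list \<Rightarrow> nat" where
  "sdepth_decomposition D = Min ((\<lambda>(u, Z). card Z) ` set D)"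

definition sdepth :: "nat \<Rightarrow> (('k::field) mpoly, 'b, 'm) graded_module_scheme \<Rightarrow> ereal" where
  "sdepth n M = (SUP D \<in> {D. stanley_decomposition n M D}. ereal (real (sdepth_decomposition D)))"


section \<open>The graded module J/I\<close>

text \<open>
  Elements are the cosets \<open>I + f\<close> with \<open>f \<in> J\<close>; the component of degree
  \<open>a\<close> consists of the cosets of those \<open>f \<in> J\<close> all of whose monomials have exponent
  vector \<open>a\<close>. The fields \<open>mult\<close> and \<open>one\<close>, which module records inherit from
  ring records, carry no meaning for a module.
\<close>

definition ideal_quotient ::
  "nat \<Rightarrow> ('k::field) mpoly set \<Rightarrow> 'k mpoly set \<Rightarrow> ('k mpoly, 'k mpoly set) graded_module" where
  "ideal_quotient n J I = (let S = poly_ring {..<n} in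
     \<lparr>carrier = {I +>\<^bsub>S\<^esub> f | f. f \<in> J},
      mult = undefined, one = undefined,
      zero = I, add = set_add S,
      smult = (\<lambda>r X. \<Union>x\<in>X. I +>\<^bsub>S\<^esub> (r \<otimes>\<^bsub>S\<^esub> x)),
      component = (\<lambda>a. {I +>\<^bsub>S\<^esub> f | f. f \<in> J \<and> (\<forall>m\<in>Poly_Mapping.keys f. \<forall>i. int (Poly_Mapping.lookup m i) = a i)})\<rparr>)"

end

theory Submission
  imports Defs
begin

text \<open>
  Monomial ideals are encoded by their sets of exponent vectors, so that a Stanley decomposition of
  \<open>J/I\<close> amounts to a partition of the exponents of \<open>J\<close> not in \<open>I\<close> into cones \<open>a + \<nat>\<^sup>Z\<close>.
  For all large \<open>k\<close> a monomial \<open>v\<close> lies in \<open>\<surd>I\<close> iff \<open>v\<^sup>k \<in> I\<close>, and likewise for \<open>J\<close>; since the preimage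
  of a cone under \<open>v \<mapsto> k v\<close> is empty or a cone with the same \<open>Z\<close>, a decomposition of \<open>J/I\<close> induces one of
  \<open>\<surd>J/\<surd>I\<close> that uses only sets \<open>Z\<close> of the former. Hence, if \<open>\<surd>J \<noteq> \<surd>I\<close>,
  \<open>sdepth (J/I) \<le> sdepth (\<surd>J/\<surd>I) \<le> dim (\<surd>J/\<surd>I) \<le> dim (J/I)\<close>,
  where the last step is the inclusion of annihilators and the middle one only needs a lower bound on
  the dimension: the annihilator lies in the prime generated by the variables outside any \<open>Z\<close> that
  occurs, and adding the variables of \<open>Z\<close> one by one gives a chain of length \<open>|Z|\<close>. If
  \<open>\<surd>J = \<surd>I\<close>, both sides are \<open>-\<infinity>\<close>.
\<close>

section \<open>Exponent sets and monomial ideals\<close>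

definition exps :: "nat set \<Rightarrow> (nat \<Rightarrow>\<^sub>0 nat) set" where
  "exps Z = {m. Poly_Mapping.keys m \<subseteq> Z}"

text \<open>One encoding serves the subrings \<open>K[Z]\<close>, the monomial ideals, the primes
  generated by variables and the spans of cones; membership is a condition on single coefficients,
  and inclusions reduce to inclusions of exponent sets.\<close>

definition polys :: "(nat \<Rightarrow>\<^sub>0 nat) set \<Rightarrow> ('k::field) mpoly set" where
  "polys E = {f. Poly_Mapping.keys f \<subseteq> E}"

definition cone :: "(nat \<Rightarrow>\<^sub>0 nat) \<Rightarrow> nat set \<Rightarrow> (nat \<Rightarrow>\<^sub>0 nat) set" where
  "cone a Z = (+) a ` exps Z"

text \<open>Stability under adding exponents is closure under multiplication by monomials; the
  ideals \<open>polys E\<close> for such \<open>E\<close> are the monomial ideals of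
  \<open>S\<close>.\<close>

definition exp_ideal :: "nat \<Rightarrow> (nat \<Rightarrow>\<^sub>0 nat) set \<Rightarrow> bool" where
  "exp_ideal n E \<longleftrightarrow> E \<subseteq> exps {..<n} \<and> (\<forall>m\<in>E. \<forall>v\<in>exps {..<n}. m + v \<in> E)"

text \<open>The \<open>K\<close>-linear projection onto \<open>polys C\<close>. It serves for
  reduction modulo a prime generated by variables and for cutting a polynomial along cones.\<close>

definition part :: "(nat \<Rightarrow>\<^sub>0 nat) set \<Rightarrow> ('k::field) mpoly \<Rightarrow> 'k mpoly" where
  "part C f = Poly_Mapping.mapp (\<lambda>m c. c when m \<in> C) f"

lemma lookup_part: "Poly_Mapping.lookup (part C f) m = (if m \<in> C then Poly_Mapping.lookup f m else 0)"
  by (auto simp: part_def lookup_mapp when_def in_keys_iff)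

lemma keys_nat_add: "Poly_Mapping.keys (a + b :: nat \<Rightarrow>\<^sub>0 nat) = Poly_Mapping.keys a \<union> Poly_Mapping.keys b"
  by (auto simp: in_keys_iff lookup_add)

lemma exps_zero: "0 \<in> exps Z"
  by (simp add: exps_def)

lemma exps_add: "a + b \<in> exps Z \<longleftrightarrow> a \<in> exps Z \<and> b \<in> exps Z"
  by (simp add: exps_def keys_nat_add)

lemma exps_mono: "Y \<subseteq> Z \<Longrightarrow> exps Y \<subseteq> exps Z"
  by (auto simp: exps_def)

lemma polys_mono: "C \<subseteq> D \<Longrightarrow> polys C \<subseteq> polys D"
  by (auto simp: polys_def)

lemma polys_iff: "f \<in> polys E \<longleftrightarrow> (\<forall>m. m \<notin> E \<longrightarrow> Poly_Mapping.lookup f m = 0)"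
  by (auto simp: polys_def in_keys_iff)

lemma polys_zero: "0 \<in> polys E"
  by (simp add: polys_def)

lemma polys_add: "f \<in> polys E \<Longrightarrow> g \<in> polys E \<Longrightarrow> f + g \<in> polys E"
  by (simp add: polys_iff lookup_add)

lemma polys_diff: "f \<in> polys E \<Longrightarrow> g \<in> polys E \<Longrightarrow> f - g \<in> polys E"
  by (simp add: polys_iff lookup_minus)

lemma polys_uminus: "f \<in> polys E \<Longrightarrow> - f \<in> polys E"
  by (simp add: polys_iff)

lemma polys_sum: "(\<And>i. i \<in> A \<Longrightarrow> f i \<in> polys E) \<Longrightarrow> sum f A \<in> polys E"
  by (simp add: polys_iff lookup_sum)

lemma polys_single: "m \<in> E \<Longrightarrow> Poly_Mapping.single m c \<in> polys E"
  by (simp add: polys_def)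

lemma single_in_polys_iff: "c \<noteq> 0 \<Longrightarrow> Poly_Mapping.single m c \<in> polys E \<longleftrightarrow> m \<in> E"
  by (simp add: polys_def)

lemma polys_mult:
  assumes "f \<in> polys C" "g \<in> polys D" "\<And>a b. a \<in> C \<Longrightarrow> b \<in> D \<Longrightarrow> a + b \<in> E"
  shows "f * g \<in> polys E"
  using keys_mult[of f g] assms unfolding polys_def by blast

lemma polys_disjoint: "f \<in> polys C \<Longrightarrow> f \<in> polys D \<Longrightarrow> C \<inter> D = {} \<Longrightarrow> f = 0"
  by (rule poly_mapping_eqI) (auto simp: polys_iff)

lemma part_in_polys: "part C f \<in> polys C"
  by (simp add: polys_iff lookup_part)

lemma poly_expand: "f = (\<Sum>m\<in>Poly_Mapping.keys f. Poly_Mapping.single m (Poly_Mapping.lookup f m))"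
  by (rule poly_mapping_eqI) (auto simp: lookup_sum lookup_single when_def in_keys_iff)

lemma lookup_single_mult:
  fixes f :: "('k::field) mpoly"
  shows "Poly_Mapping.lookup (Poly_Mapping.single u c * f) (u + m) = c * Poly_Mapping.lookup f m"
proof -
  have "Poly_Mapping.single u c * f
      = (\<Sum>k\<in>Poly_Mapping.keys f. Poly_Mapping.single (u + k) (c * Poly_Mapping.lookup f k))"
    by (subst poly_expand[of f]) (simp add: sum_distrib_left mult_single)
  then show ?thesis
    by (simp add: lookup_sum lookup_single when_def in_keys_iff)
qed

section \<open>The rings \<open>K[Z]\<close>, monomial ideals and primes generated by
  variables\<close>

lemma carrier_poly_ring: "carrier (poly_ring Z) = polys (exps Z)"
  by (auto simp: poly_ring_def polys_def exps_def)

lemma poly_ring_simps [simp]: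
  "mult (poly_ring Z) = (*)" "one (poly_ring Z) = 1" "zero (poly_ring Z) = 0" "add (poly_ring Z) = (+)"
  by (simp_all add: poly_ring_def)

lemma poly_ring_closed:
  "0 \<in> carrier (poly_ring Z)" "1 \<in> carrier (poly_ring Z)"
  "f \<in> carrier (poly_ring Z) \<Longrightarrow> g \<in> carrier (poly_ring Z) \<Longrightarrow> f + g \<in> carrier (poly_ring Z)"
  "f \<in> carrier (poly_ring Z) \<Longrightarrow> g \<in> carrier (poly_ring Z) \<Longrightarrow> f - g \<in> carrier (poly_ring Z)"
  "f \<in> carrier (poly_ring Z) \<Longrightarrow> - f \<in> carrier (poly_ring Z)"
  "f \<in> carrier (poly_ring Z) \<Longrightarrow> g \<in> carrier (poly_ring Z) \<Longrightarrow> f * g \<in> carrier (poly_ring Z)"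
  unfolding carrier_poly_ring
       apply (simp_all add: polys_zero polys_add polys_diff polys_uminus)
   apply (metis exps_zero polys_single single_one)
  apply (erule (1) polys_mult)
  apply (simp add: exps_add)
  done

lemma poly_ring_cring: "cring (poly_ring Z :: ('k::field) mpoly ring)"
proof (rule cringI)
  show "abelian_group (poly_ring Z :: 'k mpoly ring)"
  proof (rule abelian_groupI)
    fix x :: "'k mpoly" assume "x \<in> carrier (poly_ring Z)"
    then show "\<exists>y\<in>carrier (poly_ring Z). y \<oplus>\<^bsub>poly_ring Z\<^esub> x = \<zero>\<^bsub>poly_ring Z\<^esub>"
      by (intro bexI[of _ "- x"]) (auto simp: poly_ring_closed)
  qed (auto simp: poly_ring_closed algebra_simps)
  show "Group.comm_monoid (poly_ring Z :: 'k mpoly ring)"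
    by (rule comm_monoidI) (auto simp: poly_ring_closed algebra_simps)
qed (auto simp: algebra_simps)

lemma poly_ring_a_inv: "x \<in> carrier (poly_ring Z) \<Longrightarrow> \<ominus>\<^bsub>poly_ring Z\<^esub> x = - x"
proof -
  assume x: "x \<in> carrier (poly_ring Z)"
  interpret cring "poly_ring Z" by (rule poly_ring_cring)
  show ?thesis
    using minus_equality[of "- x" x] x by (simp add: poly_ring_closed)
qed

lemma poly_ring_pow: "x [^]\<^bsub>poly_ring Z\<^esub> (k::nat) = x ^ k"
  by (induction k) (simp_all add: nat_pow_def power_commutes mult.commute)

lemma poly_ring_idealI:
  fixes I :: "('k::field) mpoly set"
  assumes "I \<subseteq> carrier (poly_ring Z)" "0 \<in> I"
    "\<And>f g. f \<in> I \<Longrightarrow> g \<in> I \<Longrightarrow> f + g \<in> I"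
    "\<And>r f. r \<in> carrier (poly_ring Z) \<Longrightarrow> f \<in> I \<Longrightarrow> r * f \<in> I"
  shows "ideal I (poly_ring Z)"
proof -
  interpret cring "poly_ring Z :: 'k mpoly ring" by (rule poly_ring_cring)
  have m: "- f \<in> I" if "f \<in> I" for f
    using assms(4)[of "- 1" f] that by (simp add: poly_ring_closed)
  show ?thesis
  proof (rule idealI)
    show "ring (poly_ring Z :: 'k mpoly ring)" by (rule ring_axioms)
    show "subgroup I (add_monoid (poly_ring Z))"
    proof (rule add.subgroupI)
      fix a assume "a \<in> I"
      then show "\<ominus>\<^bsub>poly_ring Z\<^esub> a \<in> I"
        using m assms(1) by (subst poly_ring_a_inv) auto
    qed (use assms in auto)
    fix a x :: "'k mpoly" assume "a \<in> I" "x \<in> carrier (poly_ring Z)"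
    then show "x \<otimes>\<^bsub>poly_ring Z\<^esub> a \<in> I" "a \<otimes>\<^bsub>poly_ring Z\<^esub> x \<in> I"
      using assms(4)[of x a] by (simp_all add: mult.commute)
  qed
qed

lemma exp_ideal_ideal:
  assumes "exp_ideal n E"
  shows "ideal (polys E) (poly_ring {..<n} :: ('a::field) mpoly ring)"
proof (rule poly_ring_idealI)
  fix r f :: "'a mpoly" assume "r \<in> carrier (poly_ring {..<n})" "f \<in> polys E"
  moreover have "a + b \<in> E" if "a \<in> exps {..<n}" "b \<in> E" for a b
    using assms that by (subst add.commute) (simp add: exp_ideal_def)
  ultimately show "r * f \<in> polys E"
    unfolding carrier_poly_ring by (rule polys_mult)
qed (use assms in \<open>auto simp: exp_ideal_def carrier_poly_ring polys_zero polys_add intro: polys_mono[THEN subsetD]\<close>)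

text \<open>Take for \<open>E\<close> the exponents of all monomials in \<open>I\<close>. The
  generators lie in \<open>polys E\<close>, so minimality of the generated ideal gives one
  inclusion; the other holds because every polynomial is the sum of its terms, each a constant times
  a monomial of \<open>I\<close>.\<close>

lemma monomial_ideal_exp_ideal:
  assumes "monomial_ideal n I"
  obtains E where "exp_ideal n E" "I = polys E"
proof -
  obtain A where A: "A \<subseteq> monomials {..<n}" and I: "I = Idl\<^bsub>poly_ring {..<n}\<^esub> A"
    using assms by (auto simp: monomial_ideal_def)
  interpret cring "poly_ring {..<n}" by (rule poly_ring_cring)
  have Ac: "A \<subseteq> carrier (poly_ring {..<n})"
    using A unfolding carrier_poly_ring monomials_def by (auto simp: exps_def intro!: polys_single)
  interpret I: ideal I "poly_ring {..<n}" unfolding I by (rule genideal_ideal[OF Ac])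
  define E where "E = {m \<in> exps {..<n}. Poly_Mapping.single m 1 \<in> I}"
  have "m + v \<in> E" if "m \<in> E" "v \<in> exps {..<n}" for m v
  proof -
    have "Poly_Mapping.single v 1 * Poly_Mapping.single m 1 \<in> I"
      using I.I_l_closed[of "Poly_Mapping.single m 1" "Poly_Mapping.single v 1"] that
      by (simp add: E_def carrier_poly_ring polys_single)
    then show ?thesis using that by (simp add: E_def exps_add mult_single add.commute)
  qed
  then have E: "exp_ideal n E" by (auto simp: exp_ideal_def E_def)
  have 1: "I \<subseteq> polys E"
    unfolding I
  proof (rule genideal_minimal[OF exp_ideal_ideal[OF E]])
    have "A \<subseteq> I" using genideal_self[OF Ac] I by simp
    then show "A \<subseteq> polys E"
      using A unfolding monomials_def by (force simp: exps_def E_def intro!: polys_single)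
  qed
  have "f \<in> I" if f: "f \<in> polys E" for f
  proof -
    have s: "Poly_Mapping.single m c \<in> I" if "m \<in> E" for m c
    proof -
      have "Poly_Mapping.single 0 c * Poly_Mapping.single m 1 \<in> I"
        using I.I_l_closed[of "Poly_Mapping.single m 1" "Poly_Mapping.single 0 c"] that
        by (simp add: E_def carrier_poly_ring polys_single exps_zero)
      then show ?thesis by (simp add: mult_single)
    qed
    have "(\<Sum>m\<in>K. Poly_Mapping.single m (Poly_Mapping.lookup f m)) \<in> I" if "finite K" "K \<subseteq> E" for K
      using that
    proof (induction K rule: finite_induct)
      case empty then show ?case using I.zero_closed by simp
    next
      case (insert x F)
      then show ?case using I.a_closed[of "Poly_Mapping.single x (Poly_Mapping.lookup f x)"] s by simp
    qed
    from this[of "Poly_Mapping.keys f"] f show ?thesis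
      using poly_expand[of f] by (simp add: polys_def)
  qed
  with 1 have "I = polys E" by blast
  with E that show ?thesis by blast
qed

text \<open>Modulo this ideal a polynomial agrees with its part in \<open>K[Z]\<close>, and \<open>K[Z]\<close> is a domain.\<close>
lemma primeideal_outside:
  assumes "Z \<subseteq> {..<n}"
  shows "primeideal (polys (exps {..<n} - exps Z)) (poly_ring {..<n} :: ('k::field) mpoly ring)"
    (is "primeideal ?Q ?S")
proof -
  \<comment> \<open>A monomial divisible by a variable outside \<open>Z\<close> remains so after
    multiplication by any monomial.\<close>
  have e: "exp_ideal n (exps {..<n} - exps Z)"
    by (auto simp: exp_ideal_def exps_add)
  interpret cring ?S by (rule poly_ring_cring)
  show ?thesis
  proof (rule primeidealI)
    show i: "ideal ?Q ?S" by (rule exp_ideal_ideal[OF e])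
    show "cring ?S" by (rule poly_ring_cring)
    show "carrier ?S \<noteq> ?Q"
    proof
      assume "carrier ?S = ?Q"
      then have "(1 :: 'k mpoly) \<in> ?Q" using poly_ring_closed(2) by blast
      then show False by (simp add: polys_def exps_zero)
    qed
    fix f g assume f: "f \<in> carrier ?S" and g: "g \<in> carrier ?S" and fg: "f \<otimes>\<^bsub>?S\<^esub> g \<in> ?Q"
    let ?f = "part (exps Z) f" and ?g = "part (exps Z) g"
    have sub: "exps Z \<subseteq> exps {..<n}" using assms by (rule exps_mono)
    have f': "f - ?f \<in> ?Q" and g': "g - ?g \<in> ?Q"
      using f g by (auto simp: polys_iff lookup_part carrier_poly_ring lookup_minus)
    have fc: "?f \<in> carrier ?S" using sub part_in_polys polys_mono unfolding carrier_poly_ring by blast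
    have "(f - ?f) * g \<in> ?Q" "?f * (g - ?g) \<in> ?Q"
      using ideal.I_l_closed[OF i g' fc] ideal.I_r_closed[OF i f' g] by auto
    moreover have "?f * ?g = f * g - (f - ?f) * g - ?f * (g - ?g)" by (simp add: algebra_simps)
    ultimately have "?f * ?g \<in> ?Q" using fg by (simp add: polys_diff)
    moreover have "?f * ?g \<in> polys (exps Z)"
      by (rule polys_mult[OF part_in_polys part_in_polys]) (simp add: exps_add)
    ultimately have "?f * ?g = 0" by (rule polys_disjoint) auto
    then have "?f = 0 \<or> ?g = 0" by simp
    then show "f \<in> ?Q \<or> g \<in> ?Q" using f' g' by auto
  qed
qed

section \<open>Chains of primes in quotient rings\<close>

text \<open>Primality pulls back along the canonical projection, a unital ring homomorphism;
  elements of \<open>I\<close> are sent to zero and hence into \<open>P\<close>.\<close>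

lemma (in ideal) primeideal_vimage_quot:
  assumes "cring R" "primeideal P (R Quot I)"
  shows "primeideal {x \<in> carrier R. I +> x \<in> P} R"
    and "I \<subseteq> {x \<in> carrier R. I +> x \<in> P}"
proof -
  interpret h: ring_hom_cring R "R Quot I" "(+>) I" by (rule rcos_ring_hom_cring[OF assms(1)])
  interpret P: primeideal P "R Quot I" by fact
  have m: "I +> x \<in> carrier (R Quot I)" if "x \<in> carrier R" for x using that h.hom_closed by simp
  show "primeideal {x \<in> carrier R. I +> x \<in> P} R"
  proof (rule primeidealI)
    show "ideal {x \<in> carrier R. I +> x \<in> P} R"
      by (rule ring_hom_ring.ideal_vimage[OF rcos_ring_hom_ring P.ideal_axioms])
    show "cring R" by fact
    show "carrier R \<noteq> {x \<in> carrier R. I +> x \<in> P}"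
    proof
      assume "carrier R = {x \<in> carrier R. I +> x \<in> P}"
      then have "I +> \<one> \<in> P" by blast
      then show False using P.one_imp_carrier P.I_notcarr h.hom_one by auto
    qed
    show "a \<in> {x \<in> carrier R. I +> x \<in> P} \<or> b \<in> {x \<in> carrier R. I +> x \<in> P}"
      if "a \<in> carrier R" "b \<in> carrier R" "a \<otimes> b \<in> {x \<in> carrier R. I +> x \<in> P}" for a b
      using that P.I_prime[OF m m, of a b] h.hom_mult[of a b] by auto
  qed
  show "I \<subseteq> {x \<in> carrier R. I +> x \<in> P}"
  proof
    fix x assume x: "x \<in> I"
    have "I +> x = \<zero>\<^bsub>R Quot I\<^esub>" unfolding FactRing_def ring.simps by (rule a_rcos_const[OF x])
    then have "I +> x \<in> P" using P.zero_closed by (rule ssubst)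
    then show "x \<in> {x \<in> carrier R. I +> x \<in> P}" using a_Hcarr[OF x] by blast
  qed
qed

text \<open>As \<open>I\<close> lies in \<open>P\<close>, membership in \<open>P\<close> depends
  only on the coset, so primality of the image can be tested on representatives.\<close>

lemma (in ideal) primeideal_image_quot:
  assumes "primeideal P R" "I \<subseteq> P"
  shows "primeideal ((+>) I ` P) (R Quot I)"
    and "\<And>x. x \<in> carrier R \<Longrightarrow> I +> x \<in> (+>) I ` P \<longleftrightarrow> x \<in> P"
proof -
  interpret P: primeideal P R by fact
  have R: "cring R" by (rule P.is_cring)
  interpret h: ring_hom_cring R "R Quot I" "(+>) I" by (rule rcos_ring_hom_cring[OF R])
  show iff: "I +> x \<in> (+>) I ` P \<longleftrightarrow> x \<in> P" if x: "x \<in> carrier R" for x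
  proof
    assume "I +> x \<in> (+>) I ` P"
    then obtain y where y: "y \<in> P" "I +> x = I +> y" by auto
    then have "x \<in> I +> y" using a_rcos_self[OF x] by simp
    then obtain z where "z \<in> I" "x = z \<oplus> y" by (auto simp: a_r_coset_def')
    then show "x \<in> P" using assms(2) y P.a_closed by auto
  qed auto
  show "primeideal ((+>) I ` P) (R Quot I)"
  proof (rule primeidealI)
    show "ideal ((+>) I ` P) (R Quot I)"
      by (rule ring_ideal_imp_quot_ideal[OF ideal_axioms P.ideal_axioms])
    show "cring (R Quot I)" by (rule h.S.is_cring)
    show "carrier (R Quot I) \<noteq> (+>) I ` P"
    proof
      assume "carrier (R Quot I) = (+>) I ` P"
      then have "I +> \<one> \<in> (+>) I ` P" using h.hom_closed[OF one_closed] by simp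
      then have "\<one> \<in> P" using iff[OF one_closed] by simp
      then show False using P.one_imp_carrier P.I_notcarr by auto
    qed
    fix a b assume "a \<in> carrier (R Quot I)" "b \<in> carrier (R Quot I)"
      and ab: "a \<otimes>\<^bsub>R Quot I\<^esub> b \<in> (+>) I ` P"
    then obtain x y where xy: "x \<in> carrier R" "a = I +> x" "y \<in> carrier R" "b = I +> y"
      unfolding FactRing_simps by force
    have "I +> (x \<otimes> y) \<in> (+>) I ` P" using ab h.hom_mult[OF xy(1,3)] unfolding xy(2,4) by metis
    then have "x \<otimes> y \<in> P" using iff[of "x \<otimes> y"] xy(1,3) by blast
    then show "a \<in> (+>) I ` P \<or> b \<in> (+>) I ` P" using P.I_prime[OF xy(1,3)] unfolding xy(2,4) by blast
  qed
qed

text \<open>Image and preimage under the projection turn strict chains into strict chains of the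
  same length. All later dimension estimates can therefore be made with primes of \<open>R\<close>
  itself.\<close>

lemma (in ideal) krull_dim_quot:
  assumes "cring R"
  shows "krull_dim (R Quot I) = (SUP k \<in> {k. \<exists>P :: nat \<Rightarrow> 'a set.
      (\<forall>i\<le>k. primeideal (P i) R \<and> I \<subseteq> P i) \<and> (\<forall>i<k. P i \<subset> P (Suc i))}. ereal (real k))"
proof -
  let ?v = "\<lambda>Q. {x \<in> carrier R. I +> x \<in> Q}"
  have "(\<exists>P. (\<forall>i\<le>k. primeideal (P i) (R Quot I)) \<and> (\<forall>i<k. P i \<subset> P (Suc i))) \<longleftrightarrow>
      (\<exists>P. (\<forall>i\<le>k. primeideal (P i) R \<and> I \<subseteq> P i) \<and> (\<forall>i<k. P i \<subset> P (Suc i)))" (is "?l \<longleftrightarrow> ?r") for k :: nat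
  proof
    assume ?l
    then obtain P where P: "\<And>i. i \<le> k \<Longrightarrow> primeideal (P i) (R Quot I)" "\<And>i. i < k \<Longrightarrow> P i \<subset> P (Suc i)"
      by blast
    have "?v (P i) \<subset> ?v (P (Suc i))" if "i < k" for i
    proof -
      \<comment> \<open>Strictness survives taking preimages because the projection is surjective:
        an element separating two primes of the quotient is the coset of some element of
        \<open>R\<close>.\<close>
      have "P (Suc i) \<subseteq> carrier (R Quot I)"
        using P(1)[of "Suc i"] that by (simp add: primeideal_def ideal_def additive_subgroup.a_subset)
      then show ?thesis using P(2)[OF that] by (auto simp: FactRing_simps)
    qed
    then show ?r using P(1) primeideal_vimage_quot[OF assms] by (intro exI[of _ "\<lambda>i. ?v (P i)"]) auto
  next
    assume ?r
    then obtain P where P: "\<And>i. i \<le> k \<Longrightarrow> primeideal (P i) R" "\<And>i. i \<le> k \<Longrightarrow> I \<subseteq> P i" "\<And>i. i < k \<Longrightarrow> P i \<subset> P (Suc i)"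
      by blast
    have "(+>) I ` P i \<subset> (+>) I ` P (Suc i)" if i: "i < k" for i
    proof -
      obtain x where x: "x \<in> P (Suc i)" "x \<notin> P i" using P(3)[OF i] by blast
      then have "x \<in> carrier R"
        using P(1)[of "Suc i"] i by (auto simp: primeideal_def ideal_def dest: additive_subgroup.a_Hcarr)
      then have "I +> x \<notin> (+>) I ` P i" using x primeideal_image_quot(2) P i by simp
      then show ?thesis using x P(3)[OF i] by blast
    qed
    then show ?l using P primeideal_image_quot(1) by (intro exI[of _ "\<lambda>i. (+>) I ` P i"]) auto
  qed
  then show ?thesis by (simp add: krull_dim_def)
qed

text \<open>A chain of primes above the larger ideal is also a chain above the smaller one.\<close>

lemma krull_dim_quot_antimono:
  fixes R :: "('a, 'b) ring_scheme"
  assumes "cring R" "ideal A R" "ideal B R" "A \<subseteq> B"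
  shows "krull_dim (R Quot B) \<le> krull_dim (R Quot A)"
  unfolding ideal.krull_dim_quot[OF assms(2,1)] ideal.krull_dim_quot[OF assms(3,1)]
proof (intro SUP_subset_mono subsetI CollectI)
  fix k assume "k \<in> {k. \<exists>P :: nat \<Rightarrow> 'a set. (\<forall>i\<le>k. primeideal (P i) R \<and> B \<subseteq> P i) \<and> (\<forall>i<k. P i \<subset> P (Suc i))}"
  then obtain P :: "nat \<Rightarrow> 'a set"
    where "\<forall>i\<le>k. primeideal (P i) R \<and> B \<subseteq> P i" "\<forall>i<k. P i \<subset> P (Suc i)" by auto
  then show "\<exists>P. (\<forall>i\<le>k. primeideal (P i) R \<and> A \<subseteq> P i) \<and> (\<forall>i<k. P i \<subset> P (Suc i))"
    using order_trans[OF assms(4)] by (intro exI[of _ P]) simp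
qed simp

lemma krull_dim_trivial:
  fixes R :: "('a, 'b) ring_scheme"
  assumes "cring R"
  shows "krull_dim (R Quot carrier R) = -\<infinity>"
proof -
  interpret cring R by fact
  have "\<not> (primeideal P R \<and> carrier R \<subseteq> P)" for P
  proof
    assume P: "primeideal P R \<and> carrier R \<subseteq> P"
    then interpret P: primeideal P R by blast
    show False using P.a_subset P.I_notcarr P by blast
  qed
  then have e: "{k. \<exists>P :: nat \<Rightarrow> 'a set. (\<forall>i\<le>k. primeideal (P i) R \<and> carrier R \<subseteq> P i) \<and>
      (\<forall>i<k. P i \<subset> P (Suc i))} = {}"
    by blast
  show ?thesis
    unfolding ideal.krull_dim_quot[OF oneideal assms] e by (simp add: bot_ereal_def)
qed

text \<open>The chain of primes generated by the variables outside \<open>Z\<close> together with initial segments of \<open>Z\<close>.\<close>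
lemma krull_dim_quot_ge:
  assumes A: "ideal A (poly_ring {..<n} :: ('k::field) mpoly ring)"
    and Z: "Z \<subseteq> {..<n}" and AZ: "A \<subseteq> polys (exps {..<n} - exps Z)"
  shows "ereal (real (card Z)) \<le> krull_dim ((poly_ring {..<n} :: 'k mpoly ring) Quot A)"
proof -
  have fin: "finite Z" using Z finite_subset by blast
  then obtain zs where zs: "set zs = Z" "distinct zs" using finite_distinct_list by blast
  then have len: "length zs = card Z" using distinct_card by metis
  \<comment> \<open>Dropping variables from \<open>zs\<close> shrinks the set of surviving
    variables, so the primes grow with \<open>i\<close>: from the one generated by the variables
    outside \<open>Z\<close> up to the one generated by all variables.\<close>
  define P :: "nat \<Rightarrow> 'k mpoly set" where "P i = polys (exps {..<n} - exps (set (drop i zs)))" for i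
  have sub: "set (drop i zs) \<subseteq> Z" for i using zs set_drop_subset by metis
  have "primeideal (P i) (poly_ring {..<n}) \<and> A \<subseteq> P i" for i
  proof
    show "primeideal (P i) (poly_ring {..<n})"
      unfolding P_def using sub[of i] Z by (intro primeideal_outside) blast
    have "polys (exps {..<n} - exps Z) \<subseteq> P i"
      unfolding P_def using exps_mono[OF sub[of i]] by (intro polys_mono) blast
    with AZ show "A \<subseteq> P i" by blast
  qed
  moreover have "P i \<subset> P (Suc i)" if "i < card Z" for i
  proof -
    have d: "drop i zs = zs ! i # drop (Suc i) zs" using that len by (simp add: Cons_nth_drop_Suc)
    have "distinct (drop i zs)" using zs by simp
    then have n: "zs ! i \<notin> set (drop (Suc i) zs)" using d by simp
    have z: "zs ! i \<in> {..<n}" using that len zs Z nth_mem by (metis subsetD)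
    \<comment> \<open>The variable dropped at this stage witnesses strictness.\<close>
    let ?x = "Poly_Mapping.single (Poly_Mapping.single (zs ! i) 1) 1 :: 'k mpoly"
    have "?x \<in> P (Suc i)" "?x \<notin> P i"
      using z n d by (auto simp: P_def polys_def exps_def)
    moreover have "P i \<subseteq> P (Suc i)"
    proof -
      have "set (drop (Suc i) zs) \<subseteq> set (drop i zs)" unfolding d by auto
      then show ?thesis unfolding P_def using exps_mono by (intro polys_mono) blast
    qed
    ultimately show ?thesis by blast
  qed
  ultimately show ?thesis
    unfolding ideal.krull_dim_quot[OF A poly_ring_cring]
    by (intro SUP_upper CollectI exI[of _ P]) simp
qed

section \<open>The quotient of two monomial ideals\<close>

text \<open>Subtraction of exponents is truncated; the inequalities make
  \<open>a + (m - a) = m\<close>, and the equalities off \<open>Z\<close> put \<open>m - a\<close>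
  into \<open>exps Z\<close>.\<close>

lemma mem_cone:
  "m \<in> cone a Z \<longleftrightarrow> (\<forall>i. Poly_Mapping.lookup a i \<le> Poly_Mapping.lookup m i) \<and>
     (\<forall>i. i \<notin> Z \<longrightarrow> Poly_Mapping.lookup m i = Poly_Mapping.lookup a i)"
proof
  assume "m \<in> cone a Z"
  then show "(\<forall>i. Poly_Mapping.lookup a i \<le> Poly_Mapping.lookup m i) \<and>
     (\<forall>i. i \<notin> Z \<longrightarrow> Poly_Mapping.lookup m i = Poly_Mapping.lookup a i)"
    by (auto simp: cone_def exps_def lookup_add in_keys_iff)
next
  assume r: "(\<forall>i. Poly_Mapping.lookup a i \<le> Poly_Mapping.lookup m i) \<and>
     (\<forall>i. i \<notin> Z \<longrightarrow> Poly_Mapping.lookup m i = Poly_Mapping.lookup a i)"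
  then have "m = a + (m - a)"
    by (intro poly_mapping_eqI) (simp add: lookup_add lookup_minus)
  moreover have "m - a \<in> exps Z"
    using r by (auto simp: exps_def in_keys_iff lookup_minus)
  ultimately show "m \<in> cone a Z" unfolding cone_def by blast
qed

lemma cone_self: "a \<in> cone a Z"
  by (simp add: mem_cone)

text \<open>The coset of \<open>f\<close> modulo \<open>polys E\<close>, written without the ambient
  ring, so that equality of cosets becomes a condition on the coefficients outside
  \<open>E\<close>.\<close>

definition coset :: "(nat \<Rightarrow>\<^sub>0 nat) set \<Rightarrow> ('k::field) mpoly \<Rightarrow> 'k mpoly set" where
  "coset E f = {g. g - f \<in> polys E}"

lemma a_r_coset_polys: "polys E +>\<^bsub>poly_ring Z\<^esub> f = coset E f"
  by (force simp: a_r_coset_def' coset_def)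

lemma coset_self: "f \<in> coset E f"
  by (simp add: coset_def polys_zero)

lemma coset_zero: "coset E 0 = polys E"
  by (simp add: coset_def)

lemma coset_eq_iff: "coset E f = coset E g \<longleftrightarrow> f - g \<in> polys E"
proof
  assume "coset E f = coset E g"
  then have "f \<in> coset E g" using coset_self by blast
  then show "f - g \<in> polys E" by (simp add: coset_def)
next
  assume a: "f - g \<in> polys E"
  have "h - f \<in> polys E \<longleftrightarrow> h - g \<in> polys E" for h
    using polys_add[OF _ a, of "h - f"] polys_diff[OF _ a, of "h - g"] by auto
  then show "coset E f = coset E g" by (simp add: coset_def)
qed

lemma coset_single_eq_zero_iff: "c \<noteq> 0 \<Longrightarrow> coset E (Poly_Mapping.single m c) = coset E 0 \<longleftrightarrow> m \<in> E"
  by (simp add: coset_eq_iff single_in_polys_iff)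

lemma set_add_coset: "coset E f <+>\<^bsub>poly_ring Z\<^esub> coset E g = coset E (f + g)"
proof -
  have "h \<in> coset E (f + g) \<Longrightarrow> h - g \<in> coset E f" for h
    by (simp add: coset_def algebra_simps)
  then have "h \<in> coset E (f + g) \<Longrightarrow> \<exists>x\<in>coset E f. \<exists>y\<in>coset E g. h = x + y" for h
    using coset_self[of g E] by (intro bexI[of _ "h - g"] bexI[of _ g]) auto
  moreover have "x + y \<in> coset E (f + g)" if "x \<in> coset E f" "y \<in> coset E g" for x y
    using polys_add[of "x - f" E "y - g"] that by (simp add: coset_def algebra_simps)
  ultimately show ?thesis by (auto simp: set_add_def')
qed

text \<open>\<open>G\<close> stands for the exponents of \<open>J\<close> and \<open>E\<close> for
  those of \<open>I\<close>; \<open>G - E\<close> then indexes the monomial \<open>K\<close>-basis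
  of the quotient \<open>M\<close>.\<close>

locale monomial_pair =
  fixes n :: nat and G E :: "(nat \<Rightarrow>\<^sub>0 nat) set"
  assumes G: "exp_ideal n G" and E: "exp_ideal n E" and EG: "E \<subseteq> G"
begin

abbreviation M :: "(('k::field) mpoly, 'k mpoly set) graded_module" where
  "M \<equiv> ideal_quotient n (polys G) (polys E)"

lemma carrier_M: "carrier M = coset E ` polys G"
  by (auto simp: ideal_quotient_def Let_def a_r_coset_polys)

lemma zero_M: "\<zero>\<^bsub>M\<^esub> = coset E 0"
  by (simp add: ideal_quotient_def Let_def coset_zero)

lemma add_M: "coset E f \<oplus>\<^bsub>M\<^esub> coset E g = coset E (f + g)"
  by (simp add: ideal_quotient_def Let_def set_add_coset)

lemma component_M: "component M d = {coset E f | f. f \<in> polys G \<and>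
    (\<forall>m\<in>Poly_Mapping.keys f. \<forall>i. int (Poly_Mapping.lookup m i) = d i)}"
  by (simp add: ideal_quotient_def Let_def a_r_coset_polys)

lemma ideal_polys_E:
  "r \<in> carrier (poly_ring {..<n}) \<Longrightarrow> f \<in> polys E \<Longrightarrow> r * f \<in> polys E"
  using ideal.I_l_closed[OF exp_ideal_ideal[OF E]] by fastforce

lemma ideal_polys_G:
  "r \<in> carrier (poly_ring {..<n}) \<Longrightarrow> f \<in> polys G \<Longrightarrow> r * f \<in> polys G"
  using ideal.I_l_closed[OF exp_ideal_ideal[OF G]] by fastforce

text \<open>The action is defined as a union over all representatives. Since \<open>polys E\<close>
  is an ideal, they all yield the same coset and the union collapses.\<close>

lemma smult_M:
  fixes r f :: "('k::field) mpoly"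
  assumes "r \<in> carrier (poly_ring {..<n})"
  shows "r \<odot>\<^bsub>M\<^esub> coset E f = coset E (r * f)"
proof -
  have "coset E (r * x) = coset E (r * f)" if "x \<in> coset E f" for x
    using ideal_polys_E[OF assms, of "x - f"] that
    unfolding coset_eq_iff by (simp add: coset_def right_diff_distrib)
  then have "(\<Union>x\<in>coset E f. coset E (r * x)) = coset E (r * f)"
    using coset_self[of f E] by blast
  then show ?thesis
    by (simp add: ideal_quotient_def Let_def a_r_coset_polys)
qed

lemma abelian_monoid_M: "abelian_monoid (M :: (('k::field) mpoly, 'k mpoly set) graded_module)"
proof (rule abelian_monoidI)
  show "\<zero>\<^bsub>M\<^esub> \<in> carrier (M :: ('k mpoly, 'k mpoly set) graded_module)"
    by (auto simp: carrier_M zero_M polys_zero)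
qed (auto simp: carrier_M zero_M add_M polys_add algebra_simps)

text \<open>Moves a sum in the quotient to a sum of representatives, where coefficients can be
  compared.\<close>

lemma finsum_M:
  assumes "finite A" "\<And>i. i \<in> A \<Longrightarrow> g i = coset E (f i)" "\<And>i. i \<in> A \<Longrightarrow> f i \<in> polys G"
  shows "(\<Oplus>\<^bsub>M\<^esub>i\<in>A. g i) = coset E (sum f A)"
proof -
  interpret abelian_monoid M by (rule abelian_monoid_M)
  show ?thesis
    using assms
  proof (induction A rule: finite_induct)
    case empty then show ?case by (simp add: zero_M)
  next
    case (insert x F)
    have "g \<in> F \<rightarrow> carrier M" "g x \<in> carrier M"
      using insert.prems by (auto simp: carrier_M)
    then have "(\<Oplus>\<^bsub>M\<^esub>i\<in>insert x F. g i) = g x \<oplus>\<^bsub>M\<^esub> (\<Oplus>\<^bsub>M\<^esub>i\<in>F. g i)"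
      using insert.hyps by (rule_tac finsum_insert)
    also have "\<dots> = coset E (f x) \<oplus>\<^bsub>M\<^esub> coset E (sum f F)"
      using insert.IH insert.prems by simp
    also have "\<dots> = coset E (sum f (insert x F))"
      using insert.hyps by (simp add: add_M)
    finally show ?case .
  qed
qed

lemma cone_subset_G: "a \<in> G \<Longrightarrow> Z \<subseteq> {..<n} \<Longrightarrow> cone a Z \<subseteq> G"
  using G exps_mono[of Z "{..<n}"] by (auto simp: exp_ideal_def cone_def)

lemma exps_carrier: "m \<in> exps Z \<Longrightarrow> Z \<subseteq> {..<n} \<Longrightarrow> Poly_Mapping.single m c \<in> carrier (poly_ring {..<n})"
  using exps_mono[of Z "{..<n}"] by (auto simp: carrier_poly_ring intro!: polys_single)

text \<open>Multiplying the generator by the monomials of \<open>K[Z]\<close> gives the monomials of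
  the cone, each with the factor \<open>c\<close>, which the scalars from \<open>K\<close> absorb.
  The cone may meet \<open>E\<close>; the corresponding classes are then zero.\<close>

lemma cyclic_space_M:
  fixes c :: "'k::field"
  assumes a: "a \<in> G" and c: "c \<noteq> 0" and Z: "Z \<subseteq> {..<n}"
  shows "cyclic_space M (coset E (Poly_Mapping.single a c)) Z = coset E ` polys (cone a Z)"
proof -
  let ?\<phi> = "\<lambda>m. coset E (Poly_Mapping.single m c)"
  have gen: "v \<odot>\<^bsub>M\<^esub> ?\<phi> a = ?\<phi> (a + u)" if "v = Poly_Mapping.single u 1" "u \<in> exps Z" for u v
    unfolding that(1) using smult_M[OF exps_carrier[OF that(2) Z, of "1 :: 'k"], of "Poly_Mapping.single a c"]
    by (simp add: mult_single add.commute)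
  have "{v \<odot>\<^bsub>M\<^esub> ?\<phi> a | v. v \<in> monomials Z} = {?\<phi> (a + u) | u. u \<in> exps Z}"
  proof (intro equalityI subsetI)
    fix x :: "'k mpoly set" assume "x \<in> {v \<odot>\<^bsub>M\<^esub> ?\<phi> a | v. v \<in> monomials Z}"
    then obtain u where "x = Poly_Mapping.single u 1 \<odot>\<^bsub>M\<^esub> ?\<phi> a" "u \<in> exps Z"
      by (auto simp: monomials_def exps_def)
    then show "x \<in> {?\<phi> (a + u) | u. u \<in> exps Z}" using gen by auto
  next
    fix x :: "'k mpoly set" assume "x \<in> {?\<phi> (a + u) | u. u \<in> exps Z}"
    then obtain u where u: "x = Poly_Mapping.single u 1 \<odot>\<^bsub>M\<^esub> ?\<phi> a" "u \<in> exps Z"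
      using gen by auto
    then show "x \<in> {v \<odot>\<^bsub>M\<^esub> ?\<phi> a | v. v \<in> monomials Z}"
      by (intro CollectI exI[of _ "Poly_Mapping.single u 1"]) (auto simp: monomials_def exps_def)
  qed
  also have "\<dots> = ?\<phi> ` cone a Z"
    by (auto simp: cone_def)
  finally have gens: "{v \<odot>\<^bsub>M\<^esub> ?\<phi> a | v. v \<in> monomials Z} = ?\<phi> ` cone a Z" .
  have TG: "cone a Z \<subseteq> G" by (rule cone_subset_G[OF a Z])
  have sc: "r \<in> carrier (poly_ring {..<n})" if "r \<in> carrier (poly_ring {})" for r :: "'k mpoly"
    using that exps_mono[of "{}" "{..<n}"] by (auto simp: carrier_poly_ring polys_def)
  have "lin_span (poly_ring {}) M (?\<phi> ` cone a Z) = coset E ` polys (cone a Z)"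
  proof (intro equalityI subsetI)
    fix x :: "'k mpoly set" assume "x \<in> lin_span (poly_ring {}) M (?\<phi> ` cone a Z)"
    then obtain F k where F: "finite F" "F \<subseteq> ?\<phi> ` cone a Z" "k \<in> F \<rightarrow> carrier (poly_ring {})"
      and x: "x = (\<Oplus>\<^bsub>M\<^esub>b\<in>F. k b \<odot>\<^bsub>M\<^esub> b)"
      unfolding lin_span_def by blast
    \<comment> \<open>A class can come from several exponents, namely when they lie in
      \<open>E\<close>; \<open>\<mu>\<close> chooses one in the cone.\<close>
    have "\<exists>m. b = ?\<phi> m \<and> m \<in> cone a Z" if "b \<in> F" for b using F(2) that by blast
    then obtain \<mu> where \<mu>: "\<And>b. b \<in> F \<Longrightarrow> b = ?\<phi> (\<mu> b)" "\<And>b. b \<in> F \<Longrightarrow> \<mu> b \<in> cone a Z"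
      by metis
    let ?h = "\<lambda>b. k b * Poly_Mapping.single (\<mu> b) c"
    have h: "?h b \<in> polys (cone a Z)" if "b \<in> F" for b
      using F(3) that \<mu>(2)[OF that]
      by (intro polys_mult[of "k b" "exps {}" _ "{\<mu> b}"])
        (auto simp: carrier_poly_ring exps_def intro!: polys_single)
    have "x = coset E (sum ?h F)"
      unfolding x
    proof (rule finsum_M[OF F(1)])
      fix b assume b: "b \<in> F"
      show "k b \<odot>\<^bsub>M\<^esub> b = coset E (?h b)"
        using smult_M[OF sc, of "k b" "Poly_Mapping.single (\<mu> b) c"] F(3) b \<mu>(1)[OF b] by auto
      show "?h b \<in> polys G" using h[OF b] polys_mono[OF TG] by blast
    qed
    then show "x \<in> coset E ` polys (cone a Z)" using polys_sum[of F ?h] h by blast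
  next
    fix x :: "'k mpoly set" assume "x \<in> coset E ` polys (cone a Z)"
    then obtain f where f: "f \<in> polys (cone a Z)" "x = coset E f" by blast
    \<comment> \<open>\<open>lin_span\<close> sums over a set of vectors, so different exponents
      must give different classes. This holds off \<open>E\<close>, and the terms of
      \<open>f\<close> with exponent in \<open>E\<close> vanish in the quotient.\<close>
    define K where "K = Poly_Mapping.keys f - E"
    have K: "finite K" "K \<subseteq> cone a Z" using f(1) by (auto simp: K_def polys_def)
    have inj: "inj_on ?\<phi> K"
    proof (rule inj_onI, rule ccontr)
      fix m m' assume m: "m \<in> K" "m' \<in> K" "?\<phi> m = ?\<phi> m'" "m \<noteq> m'"
      then have "Poly_Mapping.lookup (Poly_Mapping.single m c - Poly_Mapping.single m' c) m = 0"
        by (auto simp: coset_eq_iff polys_iff K_def)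
      then show False using m c by (simp add: lookup_minus lookup_single)
    qed
    let ?\<mu> = "inv_into K ?\<phi>"
    have inv: "?\<mu> (?\<phi> m) = m" if "m \<in> K" for m by (rule inv_into_f_f[OF inj that])
    \<comment> \<open>Division by \<open>c\<close> cancels the coefficient carried by the
      generators.\<close>
    define k :: "'k mpoly set \<Rightarrow> 'k mpoly" where "k b = Poly_Mapping.single 0 (Poly_Mapping.lookup f (?\<mu> b) / c)" for b
    let ?g = "\<lambda>m. Poly_Mapping.single m (Poly_Mapping.lookup f m)"
    have k: "k b \<in> carrier (poly_ring {})" for b
      by (auto simp: k_def carrier_poly_ring exps_zero intro!: polys_single)
    have "(\<Oplus>\<^bsub>M\<^esub>b\<in>?\<phi> ` K. k b \<odot>\<^bsub>M\<^esub> b) = coset E (\<Sum>b\<in>?\<phi> ` K. ?g (?\<mu> b))"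
    proof (rule finsum_M)
      fix b assume "b \<in> ?\<phi> ` K"
      then obtain m where m: "m \<in> K" "b = ?\<phi> m" "?\<mu> b = m" using inv by blast
      show "k b \<odot>\<^bsub>M\<^esub> b = coset E (?g (?\<mu> b))"
        using smult_M[OF sc[OF k], of b "Poly_Mapping.single m c"] m c
        by (simp add: k_def mult_single)
      show "?g (?\<mu> b) \<in> polys G"
        unfolding m(3) using m(1) K(2) TG by (intro polys_single) blast
    qed (use K in simp)
    also have "(\<Sum>b\<in>?\<phi> ` K. ?g (?\<mu> b)) = (\<Sum>m\<in>K. ?g m)"
      using inv by (subst sum.reindex[OF inj]) (simp add: o_def)
    also have "coset E (\<Sum>m\<in>K. ?g m) = x"
      unfolding f(2) coset_eq_iff using K(1)
      by (auto simp: polys_iff lookup_minus lookup_sum lookup_single when_def K_def in_keys_iff)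
    finally have "x = (\<Oplus>\<^bsub>M\<^esub>b\<in>?\<phi> ` K. k b \<odot>\<^bsub>M\<^esub> b)" ..
    then show "x \<in> lin_span (poly_ring {}) M (?\<phi> ` cone a Z)"
      unfolding lin_span_def using K k
      by (intro CollectI exI[of _ "?\<phi> ` K"] exI[of _ k]) auto
  qed
  then show ?thesis unfolding cyclic_space_def gens .
qed

end

section \<open>Stanley spaces as cones that avoid the exponents of \<open>I\<close>\<close>

context monomial_pair
begin

text \<open>A nonzero homogeneous class is the class of one term. Freeness excludes torsion: if the
  cone contained an exponent \<open>a + v\<close> of \<open>E\<close>, the monomial with exponent
  \<open>v\<close> would kill the whole space and in particular a basis element.\<close>

lemma stanley_space_imp:
  assumes "stanley_space n M w Z"
  obtains a and c :: "'k::field" where "c \<noteq> 0" "w = coset E (Poly_Mapping.single a c)"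
    "Z \<subseteq> {..<n}" "cone a Z \<subseteq> G - E"
proof -
  have Z: "Z \<subseteq> {..<n}" and nz: "w \<noteq> \<zero>\<^bsub>M\<^esub>" and hom: "homogeneous n M w"
    and free: "free_submodule (poly_ring Z) M (cyclic_space M w Z)"
    using assms by (auto simp: stanley_space_def)
  from hom obtain d f where f: "f \<in> polys G" "w = coset E f"
    "\<forall>m\<in>Poly_Mapping.keys f. \<forall>i. int (Poly_Mapping.lookup m i) = d i"
    by (auto simp: homogeneous_def component_M)
  have "f \<noteq> 0" using f nz by (auto simp: zero_M)
  then obtain a where a: "a \<in> Poly_Mapping.keys f"
    by (metis poly_mapping_eqI lookup_zero not_in_keys_iff_lookup_eq_zero)
  \<comment> \<open>Homogeneity prescribes every coordinate of an exponent of \<open>f\<close>, so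
    only one exponent is possible.\<close>
  have "m = a" if "m \<in> Poly_Mapping.keys f" for m
    using f(3) a that by (intro poly_mapping_eqI) (metis of_nat_eq_iff)
  with a have ks: "Poly_Mapping.keys f = {a}" by blast
  define c where "c = Poly_Mapping.lookup f a"
  have c: "c \<noteq> 0" using a by (simp add: c_def in_keys_iff)
  have fs: "f = Poly_Mapping.single a c"
    using poly_expand[of f] ks by (simp add: c_def)
  have aG: "a \<in> G" using f(1) ks by (simp add: polys_def)
  have cyc: "cyclic_space M w Z = coset E ` polys (cone a Z)"
    using cyclic_space_M[OF aG c Z] f(2) fs by simp
  obtain B where B: "B \<subseteq> cyclic_space M w Z" "lin_span (poly_ring Z) M B = cyclic_space M w Z"
    "lin_indep (poly_ring Z) M B" using free by (auto simp: free_submodule_def)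
  interpret abelian_monoid "M :: ('k mpoly, 'k mpoly set) graded_module" by (rule abelian_monoid_M)
  \<comment> \<open>An empty basis spans only zero, whereas the space contains
    \<open>w\<close>.\<close>
  have "B \<noteq> {}"
  proof
    assume "B = {}"
    then have "lin_span (poly_ring Z) M B \<subseteq> {\<zero>\<^bsub>M\<^esub>}" by (auto simp: lin_span_def)
    moreover have "f \<in> polys (cone a Z)"
      unfolding fs using cone_self by (rule polys_single)
    then have "w \<in> cyclic_space M w Z" using cyc f(2) by blast
    ultimately show False using B(2) nz by blast
  qed
  then obtain b g where b: "b \<in> B" "b = coset E g" "g \<in> polys (cone a Z)" using B(1) cyc by blast
  have "cone a Z \<inter> E = {}"
  proof (rule ccontr)
    assume "cone a Z \<inter> E \<noteq> {}"
    then obtain v where v: "v \<in> exps Z" "a + v \<in> E" by (auto simp: cone_def)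
    let ?v = "Poly_Mapping.single v (1 :: 'k)"
    have vZ: "?v \<in> carrier (poly_ring Z)" using v by (simp add: carrier_poly_ring polys_single)
    have vn: "?v \<in> carrier (poly_ring {..<n})" by (rule exps_carrier[OF v(1) Z])
    \<comment> \<open>Every exponent of the product has the form \<open>(a + v) + z\<close> and
      stays in \<open>E\<close> because \<open>a + v\<close> is there.\<close>
    have "?v * g \<in> polys E"
    proof (rule polys_mult[of ?v "{v}" g "cone a Z"])
      fix u m assume "u \<in> {v}" "m \<in> cone a Z"
      then obtain z where z: "u = v" "m = a + z" "z \<in> exps Z" by (auto simp: cone_def)
      have "(a + v) + z \<in> E"
        using E v(2) z(3) exps_mono[OF Z] by (auto simp: exp_ideal_def)
      then show "u + m \<in> E" using z by (simp add: ac_simps)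
    qed (use b in \<open>auto intro: polys_single\<close>)
    then have v0: "?v \<odot>\<^bsub>M\<^esub> b = \<zero>\<^bsub>M\<^esub>"
      unfolding b(2) smult_M[OF vn] zero_M coset_eq_iff by simp
    then have "(\<Oplus>\<^bsub>M\<^esub>x\<in>{b}. ?v \<odot>\<^bsub>M\<^esub> x) = \<zero>\<^bsub>M\<^esub>"
      by (subst finsum_insert) auto
    then have "?v = \<zero>\<^bsub>poly_ring Z\<^esub>"
      using B(3) b(1) vZ unfolding lin_indep_def
      by (elim allE[of _ "{b}"] allE[of _ "\<lambda>_. ?v"]) auto
    then show False by (metis poly_ring_simps(3) lookup_single_eq lookup_zero zero_neq_one)
  qed
  then have "cone a Z \<subseteq> G - E" using cone_subset_G[OF aG Z] by blast
  then show thesis using that c f(2) fs Z by blast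
qed

text \<open>The generator alone is a basis over \<open>K[Z]\<close>: a multiple of it has all
  exponents in the cone, hence none in \<open>E\<close>, and is zero in the quotient only if it is
  the zero polynomial.\<close>

lemma stanley_spaceI:
  fixes c :: "'k::field"
  assumes Z: "Z \<subseteq> {..<n}" and c: "c \<noteq> 0" and cone: "cone a Z \<subseteq> G - E"
  shows "stanley_space n M (coset E (Poly_Mapping.single a c)) Z"
proof -
  let ?w = "coset E (Poly_Mapping.single a c)"
  have a: "a \<in> G" "a \<notin> E" using cone cone_self[of a Z] by auto
  have aG: "Poly_Mapping.single a c \<in> polys G" using a by (intro polys_single)
  have an: "Poly_Mapping.keys a \<subseteq> {..<n}" using G a(1) by (auto simp: exp_ideal_def exps_def)
  have carr: "?w \<in> carrier M" using aG by (simp add: carrier_M)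
  have hom: "homogeneous n M ?w"
    unfolding homogeneous_def
  proof (intro exI conjI allI impI)
    show "?w \<in> component M (\<lambda>i. int (Poly_Mapping.lookup a i))"
      using aG by (auto simp: component_M intro!: exI[of _ "Poly_Mapping.single a c"] split: if_splits)
    fix i assume "n \<le> i"
    then have "i \<notin> Poly_Mapping.keys a" using an by auto
    then show "int (Poly_Mapping.lookup a i) = 0" by (simp add: in_keys_iff)
  qed
  have nz: "?w \<noteq> \<zero>\<^bsub>M\<^esub>"
    using a c by (simp add: zero_M coset_single_eq_zero_iff)
  have cyc: "cyclic_space M ?w Z = coset E ` polys (cone a Z)"
    by (rule cyclic_space_M[OF a(1) c Z])
  interpret abelian_monoid "M :: ('k mpoly, 'k mpoly set) graded_module" by (rule abelian_monoid_M)
  have rn: "r \<in> carrier (poly_ring {..<n})" if "r \<in> carrier (poly_ring Z)" for r :: "'k mpoly"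
    using that polys_mono[OF exps_mono[OF Z]] unfolding carrier_poly_ring by blast
  have rw: "r \<odot>\<^bsub>M\<^esub> ?w = coset E (r * Poly_Mapping.single a c)" if "r \<in> carrier (poly_ring Z)" for r
    by (rule smult_M[OF rn[OF that]])
  have rc: "r * Poly_Mapping.single a c \<in> polys (cone a Z)" if "r \<in> carrier (poly_ring Z)" for r
    using that unfolding carrier_poly_ring
    by (rule polys_mult[where D = "{a}"]) (auto simp: cone_def add.commute intro: polys_single)
  have fs: "(\<Oplus>\<^bsub>M\<^esub>x\<in>{?w}. k x \<odot>\<^bsub>M\<^esub> x) = coset E (k ?w * Poly_Mapping.single a c)"
    if "k ?w \<in> carrier (poly_ring Z)" for k
  proof -
    have "(\<Oplus>\<^bsub>M\<^esub>x\<in>{?w}. k x \<odot>\<^bsub>M\<^esub> x) = coset E (\<Sum>x\<in>{?w}. k ?w * Poly_Mapping.single a c)"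
      using rw[OF that] ideal_polys_G[OF rn[OF that] aG] by (intro finsum_M) auto
    then show ?thesis by simp
  qed
  have span: "lin_span (poly_ring Z) M {?w} = cyclic_space M ?w Z"
  proof (intro equalityI subsetI)
    fix x :: "'k mpoly set" assume "x \<in> lin_span (poly_ring Z) M {?w}"
    then obtain F k where F: "F \<subseteq> {?w}" "k \<in> F \<rightarrow> carrier (poly_ring Z)"
      and x: "x = (\<Oplus>\<^bsub>M\<^esub>b\<in>F. k b \<odot>\<^bsub>M\<^esub> b)"
      unfolding lin_span_def by blast
    show "x \<in> cyclic_space M ?w Z"
    proof (cases "F = {}")
      case True
      then show ?thesis unfolding cyc x by (auto simp: zero_M polys_zero)
    next
      case False
      then have F': "F = {?w}" using F by blast
      then have k: "k ?w \<in> carrier (poly_ring Z)" using F(2) by blast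
      show ?thesis unfolding x F' fs[of k, OF k] cyc using rc[OF k] by blast
    qed
  next
    fix x :: "'k mpoly set" assume "x \<in> cyclic_space M ?w Z"
    then obtain f where f: "f \<in> polys (cone a Z)" "x = coset E f" unfolding cyc by blast
    \<comment> \<open>\<open>r\<close> is \<open>f\<close> divided by the term with exponent
      \<open>a\<close> and coefficient \<open>c\<close>; the division is exact because all exponents
      of \<open>f\<close> lie in the cone.\<close>
    define r where "r = (\<Sum>m\<in>Poly_Mapping.keys f. Poly_Mapping.single (m - a) (Poly_Mapping.lookup f m / c))"
    have d: "m - a \<in> exps Z \<and> (m - a) + a = m" if "m \<in> Poly_Mapping.keys f" for m
    proof -
      have "m \<in> cone a Z" using that f(1) by (auto simp: polys_def)
      then obtain v where "m = a + v" "v \<in> exps Z" by (auto simp: cone_def)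
      then show ?thesis by (simp add: add.commute)
    qed
    have r: "r \<in> carrier (poly_ring Z)"
      unfolding carrier_poly_ring r_def using d by (intro polys_sum polys_single) blast
    have "r * Poly_Mapping.single a c
        = (\<Sum>m\<in>Poly_Mapping.keys f. Poly_Mapping.single m (Poly_Mapping.lookup f m))"
      unfolding r_def sum_distrib_right using d c by (intro sum.cong) (auto simp: mult_single)
    then have "r * Poly_Mapping.single a c = f" using poly_expand[of f] by simp
    then have "x = (\<Oplus>\<^bsub>M\<^esub>b\<in>{?w}. r \<odot>\<^bsub>M\<^esub> b)" using fs[of "\<lambda>_. r"] r f(2) by simp
    then show "x \<in> lin_span (poly_ring Z) M {?w}"
      unfolding lin_span_def using r by (intro CollectI exI[of _ "{?w}"] exI[of _ "\<lambda>_. r"]) auto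
  qed
  have indep: "lin_indep (poly_ring Z) M {?w}"
    unfolding lin_indep_def
  proof (intro allI impI ballI)
    fix F k b
    assume A: "finite F \<and> F \<subseteq> {?w} \<and> k \<in> F \<rightarrow> carrier (poly_ring Z) \<and>
        (\<Oplus>\<^bsub>M\<^esub>b\<in>F. k b \<odot>\<^bsub>M\<^esub> b) = \<zero>\<^bsub>M\<^esub>" and b: "b \<in> F"
    then have F: "F = {?w}" "b = ?w" by auto
    then have k: "k ?w \<in> carrier (poly_ring Z)" using A by blast
    have "coset E (k ?w * Poly_Mapping.single a c) = coset E 0"
      using A fs[of k, OF k] unfolding F(1) zero_M by simp
    then have "k ?w * Poly_Mapping.single a c \<in> polys E" by (simp add: coset_eq_iff)
    then have "k ?w * Poly_Mapping.single a c = 0"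
      using cone by (intro polys_disjoint[OF rc[OF k]]) auto
    moreover have "Poly_Mapping.single a c \<noteq> 0" using c by (metis lookup_single_eq lookup_zero)
    ultimately show "k b = \<zero>\<^bsub>poly_ring Z\<^esub>" unfolding F(2) by simp
  qed
  have "{?w} \<subseteq> cyclic_space M ?w Z"
    unfolding cyc using cone_self[of a Z] by (auto intro!: imageI polys_single)
  then show ?thesis
    unfolding stanley_space_def free_submodule_def
    using carr hom nz Z span indep by blast
qed

end

section \<open>Stanley decompositions as partitions of exponents into cones\<close>

text \<open>The combinatorial form of a Stanley decomposition. A set of pairs can replace a list
  because a summand repeated in the list would contradict directness of the sum.\<close>

definition cone_partition ::
  "nat \<Rightarrow> (nat \<Rightarrow>\<^sub>0 nat) set \<Rightarrow> ((nat \<Rightarrow>\<^sub>0 nat) \<times> nat set) set \<Rightarrow> bool" where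
  "cone_partition n C P \<longleftrightarrow> finite P \<and> P \<noteq> {} \<and>
     (\<forall>(a, Z)\<in>P. Z \<subseteq> {..<n} \<and> cone a Z \<subseteq> C) \<and>
     (\<forall>m\<in>C. \<exists>!p. p \<in> P \<and> m \<in> cone (fst p) (snd p))"

lemma cone_partitionD:
  assumes "cone_partition n C P" "p \<in> P"
  shows "snd p \<subseteq> {..<n}" "cone (fst p) (snd p) \<subseteq> C"
  using assms unfolding cone_partition_def case_prod_beta by blast+

context monomial_pair
begin

text \<open>Decompose the class of a monomial with exponent \<open>m\<close> in
  \<open>G - E\<close>. Some component has a nonzero coefficient at \<open>m\<close>, so
  \<open>m\<close> lies in its cone; and if \<open>m\<close> lay in two cones, the class could be
  placed in either summand, giving two representations.\<close>

lemma cone_partition_of_stanley_decomposition: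
  fixes D :: "(('k::field) mpoly set \<times> nat set) list"
  assumes D: "stanley_decomposition n M D"
  obtains P where "cone_partition n (G - E) P" "snd ` P = snd ` set D"
proof -
  let ?L = "{..<length D}"
  have "\<exists>a c. c \<noteq> 0 \<and> fst (D ! i) = coset E (Poly_Mapping.single a c) \<and>
      snd (D ! i) \<subseteq> {..<n} \<and> cone a (snd (D ! i)) \<subseteq> G - E" if "i \<in> ?L" for i
  proof -
    have "D ! i \<in> set D" using that by simp
    then have "stanley_space n M (fst (D ! i)) (snd (D ! i))"
      using D by (auto simp: stanley_decomposition_def split: prod.splits)
    then show ?thesis by (rule stanley_space_imp) blast
  qed
  then obtain a c where ac: "\<And>i. i \<in> ?L \<Longrightarrow> c i \<noteq> 0"
    "\<And>i. i \<in> ?L \<Longrightarrow> fst (D ! i) = coset E (Poly_Mapping.single (a i) (c i))"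
    "\<And>i. i \<in> ?L \<Longrightarrow> snd (D ! i) \<subseteq> {..<n}"
    "\<And>i. i \<in> ?L \<Longrightarrow> cone (a i) (snd (D ! i)) \<subseteq> G - E" by metis
  define T where "T i = cone (a i) (snd (D ! i))" for i
  have T: "T i \<subseteq> G - E" if "i \<in> ?L" for i using ac(4)[OF that] by (simp add: T_def)
  have cyc: "cyclic_space M (fst (D ! i)) (snd (D ! i)) = coset E ` polys (T i)" if "i \<in> ?L" for i
  proof -
    have "a i \<in> G" using ac(4)[OF that] cone_self by blast
    then show ?thesis using cyclic_space_M[OF _ ac(1)[OF that] ac(3)[OF that]] ac(2)[OF that]
      by (simp add: T_def)
  qed
  have dec: "\<exists>!f. f \<in> (\<Pi>\<^sub>E i\<in>?L. cyclic_space M (fst (D ! i)) (snd (D ! i))) \<and> x = (\<Oplus>\<^bsub>M\<^esub>i\<in>?L. f i)"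
    if "x \<in> carrier M" for x
    using D that by (auto simp: stanley_decomposition_def)
  have ex1: "\<exists>!i. i \<in> ?L \<and> m \<in> T i" if m: "m \<in> G - E" for m
  proof -
    let ?s = "Poly_Mapping.single m (1::'k)"
    have "?s \<in> polys G" using m by (intro polys_single) blast
    then have x: "coset E ?s \<in> carrier M" by (simp add: carrier_M)
    obtain f where f: "f \<in> (\<Pi>\<^sub>E i\<in>?L. cyclic_space M (fst (D ! i)) (snd (D ! i)))"
      "coset E ?s = (\<Oplus>\<^bsub>M\<^esub>i\<in>?L. f i)" using dec[OF x] by blast
    have "\<exists>g. g \<in> polys (T i) \<and> f i = coset E g" if "i \<in> ?L" for i
    proof -
      have "f i \<in> cyclic_space M (fst (D ! i)) (snd (D ! i))" using f(1) that by (rule PiE_mem)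
      then show ?thesis using cyc[OF that] by auto
    qed
    then obtain g where g: "\<And>i. i \<in> ?L \<Longrightarrow> g i \<in> polys (T i)" "\<And>i. i \<in> ?L \<Longrightarrow> f i = coset E (g i)"
      by metis
    have gG: "g i \<in> polys G" if "i \<in> ?L" for i
      using g(1)[OF that] polys_mono[of "T i" G] T[OF that] by blast
    have "coset E ?s = coset E (sum g ?L)"
      unfolding f(2) using g(2) gG by (intro finsum_M) auto
    \<comment> \<open>Since \<open>m\<close> is not in \<open>E\<close>, passing to the quotient
      preserves the coefficient at \<open>m\<close>.\<close>
    then have "Poly_Mapping.lookup (?s - sum g ?L) m = 0"
      using m by (simp add: coset_eq_iff polys_iff)
    then have "(\<Sum>i\<in>?L. Poly_Mapping.lookup (g i) m) \<noteq> 0"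
      by (simp add: lookup_minus lookup_sum)
    then obtain i where i: "i \<in> ?L" "Poly_Mapping.lookup (g i) m \<noteq> 0" by (rule sum.not_neutral_contains_not_neutral)
    then have "m \<in> T i" using g(1)[OF i(1)] by (auto simp: polys_iff)
    moreover have "j = k" if jk: "j \<in> ?L" "m \<in> T j" "k \<in> ?L" "m \<in> T k" for j k
    proof (rule ccontr)
      assume ne: "j \<noteq> k"
      \<comment> \<open>\<open>h j\<close> puts the class of the monomial into the summand
        \<open>j\<close> and zero into all others.\<close>
      define h where "h j = (\<lambda>i\<in>?L. coset E (if i = j then ?s else 0))" for j
      have h: "h j \<in> (\<Pi>\<^sub>E i\<in>?L. cyclic_space M (fst (D ! i)) (snd (D ! i))) \<and> coset E ?s = (\<Oplus>\<^bsub>M\<^esub>i\<in>?L. h j i)"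
        if j: "j \<in> ?L" "m \<in> T j" for j
      proof
        show "h j \<in> (\<Pi>\<^sub>E i\<in>?L. cyclic_space M (fst (D ! i)) (snd (D ! i)))"
        proof (rule PiE_I)
          fix i assume i: "i \<in> ?L"
          then show "h j i \<in> cyclic_space M (fst (D ! i)) (snd (D ! i))"
            unfolding cyc[OF i] h_def using j by (auto intro!: imageI polys_single polys_zero)
        qed (simp add: h_def)
        have "(\<Oplus>\<^bsub>M\<^esub>i\<in>?L. h j i) = coset E (\<Sum>i\<in>?L. if i = j then ?s else 0)"
          using m by (intro finsum_M) (auto simp: h_def intro!: polys_single polys_zero)
        also have "(\<Sum>i\<in>?L. if i = j then ?s else 0) = ?s" using j(1) by simp
        finally show "coset E ?s = (\<Oplus>\<^bsub>M\<^esub>i\<in>?L. h j i)" ..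
      qed
      have "h j = h k" using dec[OF x] h[OF jk(1,2)] h[OF jk(3,4)] by blast
      then have "h j j = h k j" by simp
      then have "coset E ?s = coset E 0" using jk ne by (simp add: h_def)
      then show False using m by (simp add: coset_single_eq_zero_iff)
    qed
    ultimately show ?thesis using i(1) by blast
  qed
  define P where "P = (\<lambda>i. (a i, snd (D ! i))) ` ?L"
  have "\<exists>!p. p \<in> P \<and> m \<in> cone (fst p) (snd p)" if m: "m \<in> G - E" for m
  proof -
    obtain i where i: "i \<in> ?L" "m \<in> T i" and u: "\<And>j. j \<in> ?L \<Longrightarrow> m \<in> T j \<Longrightarrow> j = i"
      using ex1[OF m] by blast
    show ?thesis
    proof (rule ex1I[of _ "(a i, snd (D ! i))"])
      fix p assume p: "p \<in> P \<and> m \<in> cone (fst p) (snd p)"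
      then obtain j where "j \<in> ?L" "p = (a j, snd (D ! j))" by (auto simp: P_def)
      then show "p = (a i, snd (D ! i))" using p u[of j] by (simp add: T_def)
    qed (use i in \<open>auto simp: P_def T_def\<close>)
  qed
  moreover have "D \<noteq> []" using D by (simp add: stanley_decomposition_def)
  then have "P \<noteq> {}" by (auto simp: P_def lessThan_empty_iff)
  moreover have "\<forall>(a, Z)\<in>P. Z \<subseteq> {..<n} \<and> cone a Z \<subseteq> G - E"
    using ac(3,4) by (auto simp: P_def)
  ultimately have "cone_partition n (G - E) P"
    by (simp add: cone_partition_def P_def)
  moreover have "snd ` P = snd ` set D"
    by (force simp: P_def image_image set_conv_nth)
  ultimately show thesis by (rule that)
qed

text \<open>A class is decomposed by cutting a representative along the cones. The cones are
  disjoint and avoid \<open>E\<close>, so the class determines every coefficient of every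
  component.\<close>

lemma stanley_decomposition_of_cone_partition:
  assumes P: "cone_partition n (G - E) P"
  obtains D :: "(('k::field) mpoly set \<times> nat set) list"
  where "stanley_decomposition n M D" "snd ` set D = snd ` P"
proof -
  have "finite P" using P by (simp add: cone_partition_def)
  then obtain ps where ps: "set ps = P" "distinct ps"
    using finite_distinct_list by blast
  define D :: "('k mpoly set \<times> nat set) list"
    where "D = map (\<lambda>p. (coset E (Poly_Mapping.single (fst p) 1), snd p)) ps"
  let ?L = "{..<length D}"
  define T where "T i = cone (fst (ps ! i)) (snd (ps ! i))" for i
  have len: "length ps = length D" by (simp add: D_def)
  have nth: "fst (D ! i) = coset E (Poly_Mapping.single (fst (ps ! i)) 1)" "snd (D ! i) = snd (ps ! i)"
    if "i \<in> ?L" for i using that by (simp_all add: D_def)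
  have pP: "snd p \<subseteq> {..<n} \<and> cone (fst p) (snd p) \<subseteq> G - E" if "p \<in> P" for p
    using cone_partitionD[OF P that] by blast
  have iP: "ps ! i \<in> P" if "i \<in> ?L" for i using that ps(1) len by auto
  have T: "T i \<subseteq> G - E" if "i \<in> ?L" for i using pP[OF iP[OF that]] by (simp add: T_def)
  \<comment> \<open>The partition identifies the pairs, and distinctness of \<open>ps\<close> then
    identifies the indices.\<close>
  have uni: "i = j" if "i \<in> ?L" "j \<in> ?L" "m \<in> T i" "m \<in> T j" for i j m
  proof -
    have "m \<in> G - E" using T that by blast
    then have "ps ! i = ps ! j"
      using P iP[OF that(1)] iP[OF that(2)] that(3,4) unfolding cone_partition_def T_def by blast
    then show ?thesis using ps(2) that(1,2) len by (simp add: nth_eq_iff_index_eq)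
  qed
  have cover: "\<exists>i\<in>?L. m \<in> T i" if "m \<in> G - E" for m
  proof -
    obtain p where p: "p \<in> set ps" "m \<in> cone (fst p) (snd p)"
      using P \<open>m \<in> G - E\<close> ps(1) unfolding cone_partition_def by blast
    then obtain i where "i < length ps" "ps ! i = p" by (auto simp: in_set_conv_nth)
    then show ?thesis using p(2) len by (auto simp: T_def)
  qed
  have cyc: "cyclic_space M (fst (D ! i)) (snd (D ! i)) = coset E ` polys (T i)" if "i \<in> ?L" for i
  proof -
    have "fst (ps ! i) \<in> G" using T[OF that] cone_self by (auto simp: T_def)
    moreover have "snd (ps ! i) \<subseteq> {..<n}" using pP[OF iP[OF that]] by blast
    ultimately show ?thesis
      unfolding nth[OF that] T_def by (intro cyclic_space_M) auto
  qed
  \<comment> \<open>At an exponent of the cone \<open>T j\<close> only the component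
    \<open>g j\<close> contributes to the sum.\<close>
  have lsum: "(\<Sum>i\<in>?L. Poly_Mapping.lookup (g i) m) = Poly_Mapping.lookup (g j) m"
    if "\<And>i. i \<in> ?L \<Longrightarrow> g i \<in> polys (T i)" "j \<in> ?L" "m \<in> T j" for g :: "nat \<Rightarrow> 'k mpoly" and j m
  proof -
    have "Poly_Mapping.lookup (g i) m = 0" if "i \<in> ?L" "i \<noteq> j" for i
      using \<open>\<And>i. i \<in> ?L \<Longrightarrow> g i \<in> polys (T i)\<close>[OF that(1)] uni[of i j m] that \<open>j \<in> ?L\<close> \<open>m \<in> T j\<close>
      by (auto simp: polys_iff)
    then have "(\<Sum>i\<in>?L. Poly_Mapping.lookup (g i) m) = (\<Sum>i\<in>?L. if i = j then Poly_Mapping.lookup (g j) m else 0)"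
      by (intro sum.cong) auto
    then show ?thesis using that(2) by simp
  qed
  have "\<exists>!h. h \<in> (\<Pi>\<^sub>E i\<in>?L. cyclic_space M (fst (D ! i)) (snd (D ! i))) \<and> x = (\<Oplus>\<^bsub>M\<^esub>i\<in>?L. h i)"
    if "x \<in> carrier M" for x
  proof -
    obtain f where f: "f \<in> polys G" "x = coset E f" using \<open>x \<in> carrier M\<close> by (auto simp: carrier_M)
    define h where "h = (\<lambda>i\<in>?L. coset E (part (T i) f))"
    have TG: "polys (T i) \<subseteq> polys G" if "i \<in> ?L" for i using T[OF that] by (intro polys_mono) blast
    show ?thesis
    proof (rule ex1I[of _ h], intro conjI)
      show "h \<in> (\<Pi>\<^sub>E i\<in>?L. cyclic_space M (fst (D ! i)) (snd (D ! i)))"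
      proof (rule PiE_I)
        fix i assume i: "i \<in> ?L"
        then show "h i \<in> cyclic_space M (fst (D ! i)) (snd (D ! i))"
          unfolding cyc[OF i] h_def using part_in_polys by auto
      qed (simp add: h_def)
      have "(\<Oplus>\<^bsub>M\<^esub>i\<in>?L. h i) = coset E (\<Sum>i\<in>?L. part (T i) f)"
        using TG part_in_polys by (intro finsum_M) (auto simp: h_def)
      also have "\<dots> = coset E f"
        unfolding coset_eq_iff polys_iff
      proof (intro allI impI)
        fix m assume m: "m \<notin> E"
        \<comment> \<open>Off \<open>E\<close>, an exponent of \<open>G\<close> lies in exactly one
          cone, whereas outside \<open>G\<close> the polynomial \<open>f\<close> has no
          term.\<close>
        have "(\<Sum>i\<in>?L. Poly_Mapping.lookup (part (T i) f) m) = Poly_Mapping.lookup f m"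
        proof (cases "m \<in> G")
          case True
          then obtain j where j: "j \<in> ?L" "m \<in> T j" using cover m by blast
          show ?thesis
            using lsum[of "\<lambda>i. part (T i) f", OF part_in_polys j] j by (simp add: lookup_part)
        next
          case False
          then have "Poly_Mapping.lookup f m = 0" using f(1) by (simp add: polys_iff)
          then show ?thesis by (simp add: lookup_part cong: if_cong)
        qed
        then show "Poly_Mapping.lookup ((\<Sum>i\<in>?L. part (T i) f) - f) m = 0"
          by (simp add: lookup_minus lookup_sum)
      qed
      finally show "x = (\<Oplus>\<^bsub>M\<^esub>i\<in>?L. h i)" using f(2) by simp
    next
      fix h' assume h': "h' \<in> (\<Pi>\<^sub>E i\<in>?L. cyclic_space M (fst (D ! i)) (snd (D ! i))) \<and> x = (\<Oplus>\<^bsub>M\<^esub>i\<in>?L. h' i)"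
      have "\<exists>g. g \<in> polys (T i) \<and> h' i = coset E g" if "i \<in> ?L" for i
      proof -
        have "h' i \<in> cyclic_space M (fst (D ! i)) (snd (D ! i))" using h' that by (blast intro: PiE_mem)
        then show ?thesis using cyc[OF that] by auto
      qed
      then obtain g where g: "\<And>i. i \<in> ?L \<Longrightarrow> g i \<in> polys (T i)" "\<And>i. i \<in> ?L \<Longrightarrow> h' i = coset E (g i)"
        by metis
      have "(\<Oplus>\<^bsub>M\<^esub>i\<in>?L. h' i) = coset E (sum g ?L)"
        using g(2) subsetD[OF TG g(1)] by (intro finsum_M) auto
      then have e: "sum g ?L - f \<in> polys E" using h' f(2) coset_eq_iff[of E "sum g ?L" f] by simp
      \<comment> \<open>Uniqueness: inside \<open>T i\<close>, hence off \<open>E\<close>, the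
        coefficients agree with those of \<open>f\<close>; outside \<open>T i\<close> both sides
        have none.\<close>
      have "g i = part (T i) f" if i: "i \<in> ?L" for i
      proof (rule poly_mapping_eqI)
        fix m
        show "Poly_Mapping.lookup (g i) m = Poly_Mapping.lookup (part (T i) f) m"
        proof (cases "m \<in> T i")
          case True
          then have "Poly_Mapping.lookup (sum g ?L - f) m = 0"
            using e T[OF i] by (auto simp: polys_iff)
          then show ?thesis
            using lsum[of g, OF g(1) i True] True by (simp add: lookup_minus lookup_sum lookup_part)
        next
          case False
          then show ?thesis using g(1)[OF i] by (simp add: polys_iff lookup_part)
        qed
      qed
      then show "h' = h"
        using h' g(2) by (intro PiE_ext[of h' ?L]) (auto simp: h_def)
    qed
  qed
  moreover have "D \<noteq> []" using P ps(1) by (auto simp: D_def cone_partition_def)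
  moreover have "\<forall>(u, Z)\<in>set D. stanley_space n M u Z"
    using pP ps(1) by (auto simp: D_def intro!: stanley_spaceI)
  ultimately have "stanley_decomposition n M D"
    by (simp add: stanley_decomposition_def)
  moreover have "snd ` set D = snd ` P"
    using ps(1) by (simp add: D_def image_image)
  ultimately show thesis by (rule that)
qed

end

section \<open>Radicals and dilation of exponents\<close>

text \<open>The exponent of the \<open>k\<close>-th power of the monomial with exponent
  \<open>m\<close>.\<close>

definition scale :: "nat \<Rightarrow> (nat \<Rightarrow>\<^sub>0 nat) \<Rightarrow> nat \<Rightarrow>\<^sub>0 nat" where
  "scale k m = Poly_Mapping.map ((*) k) m"

lemma lookup_map_zero: "f 0 = 0 \<Longrightarrow> Poly_Mapping.lookup (Poly_Mapping.map f m) i = f (Poly_Mapping.lookup m i)"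
  by (simp add: map.rep_eq when_def)

lemma lookup_scale: "Poly_Mapping.lookup (scale k m) i = k * Poly_Mapping.lookup m i"
  by (simp add: scale_def lookup_map_zero)

lemma scale_exps: "m \<in> exps Z \<Longrightarrow> scale k m \<in> exps Z"
  by (auto simp: exps_def in_keys_iff lookup_scale)

lemma exps_of_scale: "scale k m \<in> exps Z \<Longrightarrow> k > 0 \<Longrightarrow> m \<in> exps Z"
  by (auto simp: exps_def in_keys_iff lookup_scale)

lemma single_power: "Poly_Mapping.single m c ^ k = Poly_Mapping.single (scale k m) ((c::'k::field) ^ k)"
proof (induction k)
  case 0
  have "scale 0 m = 0" by (rule poly_mapping_eqI) (simp add: lookup_scale)
  then show ?case by simp
next
  case (Suc k)
  have "m + scale k m = scale (Suc k) m"
    by (rule poly_mapping_eqI) (simp add: lookup_scale lookup_add)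
  then show ?case using Suc by (simp add: mult_single)
qed

text \<open>The new corner is the old one divided by \<open>k\<close> and rounded up.\<close>
lemma cone_scale_vimage:
  assumes k: "k > 0" and v0: "scale k v0 \<in> cone a Z"
  shows "scale k v \<in> cone a Z \<longleftrightarrow> v \<in> cone (Poly_Mapping.map (\<lambda>x. (x + k - Suc 0) div k) a) Z"
proof -
  \<comment> \<open>The quotient is \<open>x / k\<close> rounded up, which is the least
    \<open>y\<close> with \<open>x \<le> k * y\<close>; hence it translates the inequalities of a
    cone.\<close>
  have ceil: "(x + k - Suc 0) div k \<le> y \<longleftrightarrow> x \<le> k * y" for x y
  proof -
    have "(x + k - Suc 0) div k \<le> y \<longleftrightarrow> (x + k - Suc 0) div k < y + 1" by auto
    also have "\<dots> \<longleftrightarrow> x + k - Suc 0 < (y + 1) * k" using k by (rule div_less_iff_less_mult)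
    also have "\<dots> \<longleftrightarrow> x \<le> k * y" using k by (auto simp: algebra_simps)
    finally show ?thesis .
  qed
  \<comment> \<open>Off \<open>Z\<close> a cone demands equality, which rounding respects only at
    multiples of \<open>k\<close>. The point \<open>v0\<close> shows that these coordinates of
    \<open>a\<close> are such multiples.\<close>
  have exact: "(k * y + k - Suc 0) div k = y" for y
    using ceil[of "k * y"] k by (metis order_antisym_conv order_refl mult_le_cancel1)
  have "(\<forall>i. i \<notin> Z \<longrightarrow> k * Poly_Mapping.lookup v i = Poly_Mapping.lookup a i)
      \<longleftrightarrow> (\<forall>i. i \<notin> Z \<longrightarrow> Poly_Mapping.lookup v i = (Poly_Mapping.lookup a i + k - Suc 0) div k)"
  proof (intro all_cong imp_cong refl)
    fix i assume "i \<notin> Z"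
    then have "Poly_Mapping.lookup a i = k * Poly_Mapping.lookup v0 i"
      using v0 by (simp add: mem_cone lookup_scale)
    then show "(k * Poly_Mapping.lookup v i = Poly_Mapping.lookup a i)
      \<longleftrightarrow> (Poly_Mapping.lookup v i = (Poly_Mapping.lookup a i + k - Suc 0) div k)"
      using exact[of "Poly_Mapping.lookup v0 i"] k by simp
  qed
  then show ?thesis
    using k by (simp add: mem_cone lookup_scale lookup_map_zero ceil)
qed

text \<open>Preimages of the blocks of a partition again partition the preimage of the whole, and
  the nonempty ones are cones with unchanged \<open>Z\<close>.\<close>

lemma cone_partition_scale_vimage:
  assumes P: "cone_partition n C P" and k: "k > 0" and ne: "{m. scale k m \<in> C} \<noteq> {}"
  obtains P' where "cone_partition n {m. scale k m \<in> C} P'" "snd ` P' \<subseteq> snd ` P"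
proof -
  define h where "h p = (Poly_Mapping.map (\<lambda>x. (x + k - Suc 0) div k) (fst p), snd p)"
    for p :: "(nat \<Rightarrow>\<^sub>0 nat) \<times> nat set"
  \<comment> \<open>Cones with empty preimage have to be discarded, since rounding up their corners
    would create cones that are not preimages.\<close>
  define P0 where "P0 = {p \<in> P. \<exists>v. scale k v \<in> cone (fst p) (snd p)}"
  have iff: "v \<in> cone (fst (h p)) (snd (h p)) \<longleftrightarrow> scale k v \<in> cone (fst p) (snd p)" if "p \<in> P0" for v p
    using that cone_scale_vimage[OF k] by (auto simp: P0_def h_def)
  have PP: "snd p \<subseteq> {..<n}" "cone (fst p) (snd p) \<subseteq> C" if "p \<in> P" for p
    using cone_partitionD[OF P that] by blast+
  have uni: "\<exists>!q. q \<in> h ` P0 \<and> m \<in> cone (fst q) (snd q)" if m: "scale k m \<in> C" for m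
  proof -
    obtain p where p: "p \<in> P" "scale k m \<in> cone (fst p) (snd p)"
      and u: "\<And>q. q \<in> P \<Longrightarrow> scale k m \<in> cone (fst q) (snd q) \<Longrightarrow> q = p"
      using P m unfolding cone_partition_def by blast
    have p0: "p \<in> P0" using p by (auto simp: P0_def)
    show ?thesis
    proof (rule ex1I[of _ "h p"])
      show "h p \<in> h ` P0 \<and> m \<in> cone (fst (h p)) (snd (h p))" using p0 p(2) iff[OF p0] by blast
      fix q assume q: "q \<in> h ` P0 \<and> m \<in> cone (fst q) (snd q)"
      then obtain q' where q': "q' \<in> P0" "q = h q'" by blast
      then have "scale k m \<in> cone (fst q') (snd q')" using q iff by blast
      then show "q = h p" using u[of q'] q' by (simp add: P0_def)
    qed
  qed
  have "cone_partition n {m. scale k m \<in> C} (h ` P0)"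
    unfolding cone_partition_def
  proof (intro conjI)
    show "finite (h ` P0)" using P by (auto simp: cone_partition_def P0_def)
    show "h ` P0 \<noteq> {}" using ne uni by blast
    show "\<forall>(a, Z)\<in>h ` P0. Z \<subseteq> {..<n} \<and> cone a Z \<subseteq> {m. scale k m \<in> C}"
    proof (intro ballI, clarify, intro conjI subsetI CollectI)
      fix a Z p x assume p: "(a, Z) = h p" "p \<in> P0"
      have pP: "p \<in> P" using p(2) by (simp add: P0_def)
      show "x \<in> {..<n}" if "x \<in> Z" using PP(1)[OF pP] that p(1) by (auto simp: h_def)
    next
      fix a Z p x assume p: "(a, Z) = h p" "p \<in> P0" and x: "x \<in> cone a Z"
      have pP: "p \<in> P" using p(2) by (simp add: P0_def)
      show "scale k x \<in> C" using iff[OF p(2), of x] x PP(2)[OF pP] p(1)[symmetric] by auto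
    qed
    show "\<forall>m\<in>{m. scale k m \<in> C}. \<exists>!p. p \<in> h ` P0 \<and> m \<in> cone (fst p) (snd p)"
      using uni by blast
  qed
  moreover have "snd ` h ` P0 \<subseteq> snd ` P" unfolding image_image h_def P0_def by auto
  ultimately show thesis by (rule that)
qed

text \<open>The exponents of the radical of \<open>polys E\<close>, as
  \<open>ideal_radical_polys\<close> confirms.\<close>

definition exp_radical :: "nat \<Rightarrow> (nat \<Rightarrow>\<^sub>0 nat) set \<Rightarrow> (nat \<Rightarrow>\<^sub>0 nat) set" where
  "exp_radical n E = {m \<in> exps {..<n}. \<exists>k>0. scale k m \<in> E}"

lemma exp_idealD:
  assumes "exp_ideal n E" "e \<in> E" "m \<in> exps {..<n}"
    and le: "\<And>i. Poly_Mapping.lookup e i \<le> Poly_Mapping.lookup m i"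
  shows "m \<in> E"
proof -
  have "Poly_Mapping.keys (m - e) \<subseteq> Poly_Mapping.keys m"
    by (auto simp: in_keys_iff lookup_minus)
  then have "m - e \<in> exps {..<n}" using assms(3) by (auto simp: exps_def)
  then have "e + (m - e) \<in> E" using assms(1,2) by (simp add: exp_ideal_def)
  moreover have "e + (m - e) = m"
    using le by (intro poly_mapping_eqI) (simp add: lookup_add lookup_minus)
  ultimately show ?thesis by simp
qed

lemma exp_ideal_radical:
  assumes "exp_ideal n E"
  shows "exp_ideal n (exp_radical n E)"
  unfolding exp_ideal_def
proof (intro conjI ballI)
  fix m v assume "m \<in> exp_radical n E" and v: "v \<in> exps {..<n}"
  then obtain k where k: "m \<in> exps {..<n}" "k > 0" "scale k m \<in> E" by (auto simp: exp_radical_def)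
  have "scale k (m + v) = scale k m + scale k v"
    by (rule poly_mapping_eqI) (simp add: lookup_scale lookup_add algebra_simps)
  then have "scale k (m + v) \<in> E"
    using assms k(3) scale_exps[OF v, of k] by (simp add: exp_ideal_def)
  then show "m + v \<in> exp_radical n E" using k v by (auto simp: exp_radical_def exps_add)
qed (auto simp: exp_radical_def)

text \<open>Every coordinate of \<open>e\<close> is at most \<open>k\<close>, and wherever it is
  nonzero \<open>m\<close> has coordinate at least 1; so the monomial of \<open>e\<close> divides
  the \<open>k\<close>-th power of that of \<open>m\<close>.\<close>

lemma scale_mem_of_keys_subset:
  assumes E: "exp_ideal n E" and e: "e \<in> E" "Poly_Mapping.keys e \<subseteq> Poly_Mapping.keys m"
    and m: "m \<in> exps {..<n}" and k: "(\<Sum>i\<in>Poly_Mapping.keys e. Poly_Mapping.lookup e i) \<le> k"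
  shows "scale k m \<in> E"
proof (rule exp_idealD[OF E e(1) scale_exps[OF m]])
  fix i
  show "Poly_Mapping.lookup e i \<le> Poly_Mapping.lookup (scale k m) i"
  proof (cases "i \<in> Poly_Mapping.keys e")
    case True
    then have "Poly_Mapping.lookup e i \<le> k"
      using member_le_sum[of i "Poly_Mapping.keys e" "Poly_Mapping.lookup e"] k by simp
    moreover have "i \<in> Poly_Mapping.keys m" using True e(2) by blast
    then have "Poly_Mapping.lookup m i \<ge> 1" by (simp add: in_keys_iff Suc_le_eq)
    ultimately show ?thesis using mult_le_mono[of "Poly_Mapping.lookup e i" k 1] by (simp add: lookup_scale)
  next
    case False
    then show ?thesis by (simp add: in_keys_iff)
  qed
qed

text \<open>A suitable exponent depends only on the support of \<open>m\<close>, and there are finitely many supports.\<close>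
lemma exp_radical_uniform:
  assumes E: "exp_ideal n E"
  obtains K where "\<And>k m. K \<le> k \<Longrightarrow> m \<in> exp_radical n E \<Longrightarrow> scale k m \<in> E"
proof -
  have "\<exists>K. \<forall>k\<ge>K. \<forall>m\<in>exp_radical n E. Poly_Mapping.keys m = F \<longrightarrow> scale k m \<in> E" for F
  proof (cases "\<exists>e\<in>E. Poly_Mapping.keys e \<subseteq> F")
    case True
    then obtain e where "e \<in> E" "Poly_Mapping.keys e \<subseteq> F" by blast
    then show ?thesis
      using scale_mem_of_keys_subset[OF E]
      by (intro exI[of _ "\<Sum>i\<in>Poly_Mapping.keys e. Poly_Mapping.lookup e i"]) (auto simp: exp_radical_def)
  next
    \<comment> \<open>No power changes the support of a monomial beyond \<open>F\<close>, so no
      exponent with support \<open>F\<close> belongs to the radical.\<close>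
    case False
    have "Poly_Mapping.keys (scale k m) \<subseteq> Poly_Mapping.keys m" for k m
      by (auto simp: in_keys_iff lookup_scale)
    then have "scale k m \<notin> E" if "Poly_Mapping.keys m = F" for k m using False that by blast
    then have "exp_radical n E \<inter> {m. Poly_Mapping.keys m = F} = {}" by (auto simp: exp_radical_def)
    then show ?thesis by blast
  qed
  then obtain K where K: "\<And>F k m. K F \<le> k \<Longrightarrow> m \<in> exp_radical n E \<Longrightarrow> Poly_Mapping.keys m = F \<Longrightarrow> scale k m \<in> E"
    by metis
  show thesis
  \<comment> \<open>The sum over all supports is a common upper bound of the finitely many
    thresholds \<open>K F\<close>.\<close>
  proof (rule that[of "\<Sum>F\<in>Pow {..<n}. K F"])
    fix k m assume k: "(\<Sum>F\<in>Pow {..<n}. K F) \<le> k" and m: "m \<in> exp_radical n E"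
    have "Poly_Mapping.keys m \<in> Pow {..<n}" using m by (auto simp: exp_radical_def exps_def)
    then have "K (Poly_Mapping.keys m) \<le> (\<Sum>F\<in>Pow {..<n}. K F)" by (intro member_le_sum) auto
    then show "scale k m \<in> E" using K[of "Poly_Mapping.keys m" k m] k m by simp
  qed
qed

section \<open>The radical of a monomial ideal\<close>

lemma of_nat_carrier: "of_nat c \<in> carrier (poly_ring Z)"
  by (induction c) (auto simp: poly_ring_closed)

lemma power_carrier: "x \<in> carrier (poly_ring Z) \<Longrightarrow> x ^ k \<in> carrier (poly_ring Z)"
  by (induction k) (auto simp: poly_ring_closed)

text \<open>In each term of the binomial expansion of \<open>(x + y) ^ (a + b)\<close> either
  \<open>x\<close> has exponent at least \<open>a\<close> or \<open>y\<close> has exponent at least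
  \<open>b\<close>.\<close>

lemma ideal_radical_add:
  fixes x y :: "('k::field) mpoly"
  assumes I: "ideal I (poly_ring Z)"
    and x: "x \<in> ideal_radical (poly_ring Z) I" and y: "y \<in> ideal_radical (poly_ring Z) I"
  shows "x + y \<in> ideal_radical (poly_ring Z) I"
proof -
  interpret ideal I "poly_ring Z :: 'k mpoly ring" by fact
  have absorb: "r * f \<in> I" if "r \<in> carrier (poly_ring Z)" "f \<in> I" for r f
    using I_l_closed[OF that(2,1)] by simp
  obtain a b where xy: "x \<in> carrier (poly_ring Z)" "y \<in> carrier (poly_ring Z)"
    and ab: "a > 0" "b > 0" "x ^ a \<in> I" "y ^ b \<in> I"
    using x y by (auto simp: ideal_radical_def poly_ring_pow)
  have t: "of_nat (a + b choose i) * x ^ i * y ^ (a + b - i) \<in> I" for i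
  proof (cases "a \<le> i")
    case True
    then have "x ^ i = x ^ (i - a) * x ^ a" by (simp flip: power_add)
    then have "of_nat (a + b choose i) * x ^ i * y ^ (a + b - i)
        = (of_nat (a + b choose i) * x ^ (i - a) * y ^ (a + b - i)) * x ^ a"
      by (simp only: mult_ac)
    moreover have "\<dots> \<in> I"
      by (intro absorb ab poly_ring_closed of_nat_carrier power_carrier xy)
    ultimately show ?thesis by (rule ssubst)
  next
    case False
    then have "y ^ (a + b - i) = y ^ (a - i) * y ^ b" by (simp flip: power_add)
    then have "of_nat (a + b choose i) * x ^ i * y ^ (a + b - i)
        = (of_nat (a + b choose i) * x ^ i * y ^ (a - i)) * y ^ b"
      by (simp only: mult_ac)
    moreover have "\<dots> \<in> I"
      by (intro absorb ab poly_ring_closed of_nat_carrier power_carrier xy)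
    ultimately show ?thesis by (rule ssubst)
  qed
  have "sum g A \<in> I" if "\<And>i. g i \<in> I" for g :: "nat \<Rightarrow> 'k mpoly" and A
    using that additive_subgroup.zero_closed[OF is_additive_subgroup]
      additive_subgroup.a_closed[OF is_additive_subgroup] by (induction A rule: infinite_finite_induct) auto
  then have "(x + y) ^ (a + b) \<in> I"
    using t by (simp add: binomial_ring)
  then show ?thesis
    using xy ab by (auto simp: ideal_radical_def poly_ring_pow poly_ring_closed intro!: exI[of _ "a + b"])
qed

text \<open>If an exponent \<open>m\<close> of \<open>x\<close> were not in the radical of
  \<open>E\<close>, the prime generated by the variables absent from \<open>m\<close> would contain
  the ideal, hence \<open>x\<close>, yet it contains no polynomial with exponent \<open>m\<close>.
  Conversely, all terms lie in the radical, which is closed under sums.\<close>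

lemma ideal_radical_polys:
  assumes E: "exp_ideal n E"
  shows "ideal_radical (poly_ring {..<n}) (polys E) = (polys (exp_radical n E) :: ('k::field) mpoly set)"
proof (intro equalityI subsetI)
  fix x :: "'k mpoly" assume "x \<in> ideal_radical (poly_ring {..<n}) (polys E)"
  then obtain k where x: "x \<in> carrier (poly_ring {..<n})" and k: "k > 0" "x ^ k \<in> polys E"
    by (auto simp: ideal_radical_def poly_ring_pow)
  have "m \<in> exp_radical n E" if m: "m \<in> Poly_Mapping.keys x" for m
  proof (rule ccontr)
    assume nm: "m \<notin> exp_radical n E"
    have mn: "m \<in> exps {..<n}" using m x by (auto simp: carrier_poly_ring polys_def)
    let ?Q = "polys (exps {..<n} - exps (Poly_Mapping.keys m)) :: 'k mpoly set"
    have "e \<notin> exps (Poly_Mapping.keys m)" if e: "e \<in> E" for e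
    proof
      assume "e \<in> exps (Poly_Mapping.keys m)"
      \<comment> \<open>The successor ensures a positive factor also when \<open>e\<close> is zero,
        as \<open>exp_radical\<close> demands.\<close>
      then have "scale (Suc (\<Sum>i\<in>Poly_Mapping.keys e. Poly_Mapping.lookup e i)) m \<in> E"
        using mn by (intro scale_mem_of_keys_subset[OF E e]) (auto simp: exps_def)
      then show False using nm mn unfolding exp_radical_def by blast
    qed
    then have "polys E \<subseteq> ?Q"
      using E by (intro polys_mono) (auto simp: exp_ideal_def)
    then have xk: "x ^ k \<in> ?Q" using k by blast
    have "Poly_Mapping.keys m \<subseteq> {..<n}" using mn by (simp add: exps_def)
    then interpret Q: primeideal ?Q "poly_ring {..<n} :: 'k mpoly ring" by (rule primeideal_outside)
    have "x \<in> ?Q" using xk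
    proof (induction k)
      case 0
      then show ?case using Q.one_imp_carrier Q.I_notcarr by simp
    next
      case (Suc k)
      then show ?case using Q.I_prime[OF x power_carrier[OF x, of k]] by auto
    qed
    then show False using m by (auto simp: polys_def exps_def)
  qed
  then show "x \<in> polys (exp_radical n E)" by (auto simp: polys_def)
next
  fix x :: "'k mpoly" assume x: "x \<in> polys (exp_radical n E)"
  let ?R = "ideal_radical (poly_ring {..<n}) (polys E) :: 'k mpoly set"
  have s: "Poly_Mapping.single m c \<in> ?R" if m: "m \<in> exp_radical n E" for m c
  proof -
    obtain k where "k > 0" "scale k m \<in> E" "m \<in> exps {..<n}" using m by (auto simp: exp_radical_def)
    then show ?thesis
      unfolding ideal_radical_def poly_ring_pow carrier_poly_ring
      by (auto simp: single_power intro!: polys_single exI[of _ k])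
  qed
  have z: "0 \<in> ?R"
    by (auto simp: ideal_radical_def poly_ring_closed poly_ring_pow polys_zero intro!: exI[of _ 1])
  have "(\<Sum>m\<in>A. Poly_Mapping.single m (Poly_Mapping.lookup x m)) \<in> ?R"
    if "finite A" "A \<subseteq> exp_radical n E" for A
    using that by (induction A rule: finite_induct) (auto intro!: z s ideal_radical_add exp_ideal_ideal[OF E])
  then show "x \<in> ?R"
    using x poly_expand[of x] by (metis finite_keys mem_Collect_eq polys_def)
qed

text \<open>The depth of a decomposition depends only on its sets \<open>Z\<close>, so comparing
  decompositions means comparing second components.\<close>

lemma sdepth_decomposition_alt: "sdepth_decomposition D = Min (card ` snd ` set D)"
  by (simp add: sdepth_decomposition_def image_image case_prod_beta)

section \<open>Annihilators, and dimension as an upper bound for Stanley depth\<close>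

context monomial_pair
begin

text \<open>This is the colon ideal of \<open>polys E\<close> by \<open>polys G\<close>.\<close>

lemma annihilator_M:
  "annihilator (poly_ring {..<n}) (M :: (('k::field) mpoly, 'k mpoly set) graded_module)
    = {r \<in> carrier (poly_ring {..<n}). \<forall>f\<in>polys G. r * f \<in> polys E}"
proof -
  have "r \<odot>\<^bsub>M\<^esub> coset E f = \<zero>\<^bsub>M\<^esub> \<longleftrightarrow> r * f \<in> polys E" if "r \<in> carrier (poly_ring {..<n})" for r f :: "'k mpoly"
    unfolding smult_M[OF that] zero_M coset_eq_iff by simp
  then show ?thesis unfolding annihilator_def carrier_M by auto
qed

lemma ideal_annihilator_M:
  "ideal (annihilator (poly_ring {..<n}) (M :: (('k::field) mpoly, 'k mpoly set) graded_module))
    (poly_ring {..<n})"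
  unfolding annihilator_M
proof (rule poly_ring_idealI)
  fix r f :: "'k mpoly"
  assume r: "r \<in> carrier (poly_ring {..<n})"
    and f: "f \<in> {r \<in> carrier (poly_ring {..<n}). \<forall>f\<in>polys G. r * f \<in> polys E}"
  have "r * f * g \<in> polys E" if "g \<in> polys G" for g
    using ideal_polys_E[OF r, of "f * g"] f that by (simp add: mult.assoc)
  then show "r * f \<in> {r \<in> carrier (poly_ring {..<n}). \<forall>f\<in>polys G. r * f \<in> polys E}"
    using r f by (simp add: poly_ring_closed)
qed (auto simp: poly_ring_closed polys_zero polys_add distrib_right)

text \<open>Any summand \<open>(a, Z)\<close> bounds the depth by \<open>card Z\<close>. An
  annihilating \<open>r\<close> kills the class with exponent \<open>a\<close>, and since the cone
  avoids \<open>E\<close>, no term of \<open>r\<close> lies in \<open>K[Z]\<close>; so the chain of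
  primes above the variables outside \<open>Z\<close> is available.\<close>

lemma sdepth_le_module_dim:
  "sdepth n (M :: (('k::field) mpoly, 'k mpoly set) graded_module)
    \<le> module_dim (poly_ring {..<n}) (M :: ('k mpoly, 'k mpoly set) graded_module)"
  unfolding sdepth_def
proof (rule SUP_least)
  fix D :: "('k mpoly set \<times> nat set) list" assume "D \<in> {D. stanley_decomposition n M D}"
  then have "stanley_decomposition n M D" by simp
  then obtain P where P: "cone_partition n (G - E) P" "snd ` P = snd ` set D"
    by (rule cone_partition_of_stanley_decomposition)
  then obtain p where p: "p \<in> P" by (auto simp: cone_partition_def)
  obtain a Z where aZ: "p = (a, Z)" by (cases p)
  have Z: "Z \<subseteq> {..<n}" and T: "cone a Z \<subseteq> G - E" using cone_partitionD[OF P(1) p] aZ by auto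
  have a: "a \<in> G" using T cone_self by blast
  have "annihilator (poly_ring {..<n}) M \<subseteq> (polys (exps {..<n} - exps Z) :: 'k mpoly set)"
    unfolding annihilator_M
  proof clarify
    fix r :: "'k mpoly" assume r: "r \<in> carrier (poly_ring {..<n})" "\<forall>f\<in>polys G. r * f \<in> polys E"
    have rE: "Poly_Mapping.single a 1 * r \<in> polys E"
      using r(2) polys_single[OF a, of 1] by (subst mult.commute) blast
    have "m \<notin> exps Z" if m: "m \<in> Poly_Mapping.keys r" for m
    proof
      assume "m \<in> exps Z"
      then have "a + m \<notin> E" using T by (auto simp: cone_def)
      \<comment> \<open>Multiplication by a monomial shifts exponents injectively, so the
        coefficient at \<open>a + m\<close> is that of \<open>r\<close> at \<open>m\<close>.\<close>
      then have "Poly_Mapping.lookup (Poly_Mapping.single a 1 * r) (a + m) = 0" using rE by (simp add: polys_iff)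
      then show False using m by (simp add: lookup_single_mult in_keys_iff)
    qed
    then show "r \<in> polys (exps {..<n} - exps Z)" using r(1) by (auto simp: carrier_poly_ring polys_def)
  qed
  then have "ereal (real (card Z)) \<le> module_dim (poly_ring {..<n}) (M :: ('k mpoly, 'k mpoly set) graded_module)"
    unfolding module_dim_def by (rule krull_dim_quot_ge[OF ideal_annihilator_M Z])
  moreover have "Z \<in> snd ` set D" using P(2) p aZ by force
  then have "sdepth_decomposition D \<le> card Z" unfolding sdepth_decomposition_alt by (intro Min_le) auto
  then have "ereal (real (sdepth_decomposition D)) \<le> ereal (real (card Z))" by simp
  ultimately show "ereal (real (sdepth_decomposition D)) \<le> module_dim (poly_ring {..<n}) (M :: ('k mpoly, 'k mpoly set) graded_module)"
    by (rule order_trans[rotated])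
qed

lemma module_dim_trivial:
  assumes "G = E"
  shows "module_dim (poly_ring {..<n}) (M :: (('k::field) mpoly, 'k mpoly set) graded_module) = -\<infinity>"
proof -
  have "annihilator (poly_ring {..<n}) (M :: ('k mpoly, 'k mpoly set) graded_module) = carrier (poly_ring {..<n})"
    unfolding annihilator_M using assms ideal_polys_E by blast
  then show ?thesis unfolding module_dim_def by (simp add: krull_dim_trivial[OF poly_ring_cring])
qed

end

section \<open>Comparing \<open>J/I\<close> with the quotient of the radicals\<close>

lemma monomial_pair_radical:
  assumes "monomial_pair n G E"
  shows "monomial_pair n (exp_radical n G) (exp_radical n E)"
proof -
  interpret monomial_pair n G E by fact
  show ?thesis
    by unfold_locales (use exp_ideal_radical G E EG in \<open>auto simp: exp_radical_def\<close>)
qed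

text \<open>If \<open>r\<close> maps \<open>J\<close> into \<open>I\<close> and \<open>x ^ k\<close>
  is in \<open>J\<close>, then \<open>(r * x) ^ k\<close> is a multiple of \<open>r * x ^ k\<close>
  and lies in \<open>I\<close>. The annihilator thus grows on passing to radicals, and the dimension
  cannot increase.\<close>

lemma module_dim_radical_le:
  assumes "monomial_pair n G E"
  defines "S \<equiv> poly_ring {..<n} :: ('k::field) mpoly ring"
  shows "module_dim S (ideal_quotient n (polys (exp_radical n G)) (polys (exp_radical n E)))
    \<le> module_dim S (ideal_quotient n (polys G) (polys E))"
proof -
  interpret M: monomial_pair n G E by fact
  interpret R: monomial_pair n "exp_radical n G" "exp_radical n E" by (rule monomial_pair_radical) fact
  have "annihilator S M.M \<subseteq> annihilator S R.M"
    unfolding S_def M.annihilator_M R.annihilator_M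
  proof (intro subsetI CollectI conjI ballI; elim CollectE conjE)
    fix r x :: "'k mpoly"
    assume r: "r \<in> carrier (poly_ring {..<n})" "\<forall>f\<in>polys G. r * f \<in> polys E"
      and x: "x \<in> polys (exp_radical n G)"
    obtain k where k: "k > 0" "x ^ k \<in> polys G" and xc: "x \<in> carrier (poly_ring {..<n})"
      using x unfolding ideal_radical_polys[OF M.G, symmetric] ideal_radical_def poly_ring_pow by blast
    have "r * x ^ k \<in> polys E" using r(2) k(2) by blast
    then have "r ^ (k - 1) * (r * x ^ k) \<in> polys E"
      by (rule M.ideal_polys_E[OF power_carrier[OF r(1)]])
    moreover have "r ^ (k - 1) * (r * x ^ k) = (r * x) ^ k"
      using k(1) by (cases k) (simp_all add: power_mult_distrib algebra_simps)
    ultimately show "r * x \<in> polys (exp_radical n E)"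
      unfolding ideal_radical_polys[OF M.E, symmetric] ideal_radical_def poly_ring_pow
      using k(1) r(1) xc by (auto simp: poly_ring_closed)
  qed
  then show ?thesis
    unfolding module_dim_def S_def
    by (rule krull_dim_quot_antimono[OF poly_ring_cring M.ideal_annihilator_M R.ideal_annihilator_M])
qed

lemma sdepth_le_radical:
  assumes "monomial_pair n G E" and ne: "exp_radical n G \<noteq> exp_radical n E"
  shows "sdepth n (ideal_quotient n (polys G) (polys E) :: (('k::field) mpoly, 'k mpoly set) graded_module)
    \<le> sdepth n (ideal_quotient n (polys (exp_radical n G)) (polys (exp_radical n E)) :: ('k mpoly, 'k mpoly set) graded_module)"
proof -
  interpret M: monomial_pair n G E by fact
  interpret R: monomial_pair n "exp_radical n G" "exp_radical n E" by (rule monomial_pair_radical) fact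
  obtain K1 where K1: "\<And>k m. K1 \<le> k \<Longrightarrow> m \<in> exp_radical n G \<Longrightarrow> scale k m \<in> G"
    by (rule exp_radical_uniform[OF M.G]) blast
  obtain K2 where K2: "\<And>k m. K2 \<le> k \<Longrightarrow> m \<in> exp_radical n E \<Longrightarrow> scale k m \<in> E"
    by (rule exp_radical_uniform[OF M.E]) blast
  \<comment> \<open>One factor has to work for both ideals at once; the successor makes it
    positive.\<close>
  define k where "k = Suc (max K1 K2)"
  have k: "k > 0" "K1 \<le> k" "K2 \<le> k" by (auto simp: k_def)
  have sub: "m \<in> exps {..<n}" if "scale k m \<in> G" for m
    using that M.G exps_of_scale[OF _ k(1)] by (auto simp: exp_ideal_def)
  \<comment> \<open>Left to right holds because \<open>k\<close> exceeds both thresholds, right to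
    left for every positive factor.\<close>
  have "m \<in> exp_radical n G \<longleftrightarrow> scale k m \<in> G" "m \<in> exp_radical n E \<longleftrightarrow> scale k m \<in> E" for m
    using K1[OF k(2)] K2[OF k(3)] sub k(1) M.EG by (auto simp: exp_radical_def)
  then have diff: "{m. scale k m \<in> G - E} = exp_radical n G - exp_radical n E" by auto
  show ?thesis
    unfolding sdepth_def
  proof (rule SUP_mono, simp)
    fix D :: "('k mpoly set \<times> nat set) list" assume "stanley_decomposition n M.M D"
    then obtain P where P: "cone_partition n (G - E) P" "snd ` P = snd ` set D"
      by (rule M.cone_partition_of_stanley_decomposition)
    have "{m. scale k m \<in> G - E} \<noteq> {}" using ne R.EG unfolding diff by blast
    then obtain P' where P': "cone_partition n (exp_radical n G - exp_radical n E) P'" "snd ` P' \<subseteq> snd ` P"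
      using cone_partition_scale_vimage[OF P(1) k(1)] unfolding diff by blast
    obtain D' :: "('k mpoly set \<times> nat set) list"
      where D': "stanley_decomposition n R.M D'" "snd ` set D' = snd ` P'"
      using R.stanley_decomposition_of_cone_partition[OF P'(1)] by blast
    \<comment> \<open>All sets \<open>Z\<close> of the new decomposition already occur in the old
      one, and a minimum over a smaller nonempty set is not smaller.\<close>
    have "card ` snd ` set D' \<subseteq> card ` snd ` set D"
      using P(2) P'(2) D'(2) by (intro image_mono[of "snd ` set D'"]) simp
    moreover have "D' \<noteq> []" using D'(1) by (simp add: stanley_decomposition_def)
    ultimately have "sdepth_decomposition D \<le> sdepth_decomposition D'"
      unfolding sdepth_decomposition_alt by (intro Min_antimono) auto
    then show "\<exists>D' :: ('k mpoly set \<times> nat set) list. stanley_decomposition n R.M D' \<and> sdepth_decomposition D \<le> sdepth_decomposition D'"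
      using D'(1) by blast
  qed
qed

theorem corollary2p3:
  fixes n :: nat and I J :: "('k::field) mpoly set"
  defines "S \<equiv> (poly_ring {..<n} :: 'k mpoly ring)"
  assumes "monomial_ideal n I" and "monomial_ideal n J" and "I \<subseteq> J"
    and "sdepth n (ideal_quotient n J I) = module_dim S (ideal_quotient n J I)"
  shows "sdepth n (ideal_quotient n (ideal_radical S J) (ideal_radical S I)) =
         module_dim S (ideal_quotient n (ideal_radical S J) (ideal_radical S I))"
proof -
  obtain E where E: "exp_ideal n E" "I = polys E" using assms(2) by (rule monomial_ideal_exp_ideal)
  obtain G where G: "exp_ideal n G" "J = polys G" using assms(3) by (rule monomial_ideal_exp_ideal)
  have "E \<subseteq> G"
  proof
    fix m assume "m \<in> E"
    then have "Poly_Mapping.single m (1::'k) \<in> polys G"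
      using \<open>I \<subseteq> J\<close> polys_single[of m E "1::'k"] E(2) G(2) by blast
    then show "m \<in> G" by (simp add: polys_def)
  qed
  then have pair: "monomial_pair n G E" using E G by unfold_locales
  interpret R: monomial_pair n "exp_radical n G" "exp_radical n E" by (rule monomial_pair_radical[OF pair])
  have rad: "ideal_radical S J = polys (exp_radical n G)" "ideal_radical S I = polys (exp_radical n E)"
    unfolding S_def E(2) G(2) using ideal_radical_polys E(1) G(1) by blast+
  have le: "sdepth n (R.M :: ('k mpoly, 'k mpoly set) graded_module) \<le> module_dim S R.M"
    unfolding S_def by (rule R.sdepth_le_module_dim)
  show ?thesis
  \<comment> \<open>Equal radicals leave the zero module, which has no Stanley decomposition to
    compare with; there the dimension \<open>-\<infinity>\<close> bounds the depth from
    above.\<close>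
  proof (cases "exp_radical n G = exp_radical n E")
    case True
    have "module_dim S (R.M :: ('k mpoly, 'k mpoly set) graded_module) = -\<infinity>"
      unfolding S_def by (rule R.module_dim_trivial[OF True])
    then show ?thesis using le unfolding rad by simp
  next
    case False
    have "module_dim S (R.M :: ('k mpoly, 'k mpoly set) graded_module) \<le> module_dim S (ideal_quotient n J I)"
      unfolding S_def E(2) G(2) by (rule module_dim_radical_le[OF pair])
    also have "\<dots> = sdepth n (ideal_quotient n J I)" using assms(5) by simp
    also have "\<dots> \<le> sdepth n (R.M :: ('k mpoly, 'k mpoly set) graded_module)"
      unfolding E(2) G(2) by (rule sdepth_le_radical[OF pair False])
    \<comment> \<open>The hypothesis on \<open>J/I\<close> links the two comparisons and yields the
      inequality opposite to \<open>le\<close>.\<close>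
    finally show ?thesis unfolding rad using le by (rule order_antisym[rotated])
  qed
qed

end
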